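(* There is a constant $c>0$ such that for infinitely many positive integers $g$, there exists a graph embeddable on a surface of Euler genus $g$ that has no $\left(2,\lfloor c\sqrt{g}\rfloor,\lfloor c\sqrt{g}\rfloor\right)$-coloring.
   Context: All graphs are finite and simple (no loops, no multiple edges). For integers $d_1,\ldots,d_k$, a $(d_1,\ldots,d_k)$-coloring of a graph $G$ is an assignment to each vertex of a color from $\{1,\ldots,k\}$ such that for each $i$, every vertex colored $i$ has at most $d_i$ neighbors colored $i$. A surface is a non-null compact connected 2-manifold without boundary. The Euler genus of a surface is $2h$ if it is the orientable surface obtained from the sphere by adding $h\ge 0$ handles, and $k$ if it is the non-orientable surface obtained from the sphere by adding $k\ge 1$ cross-caps. *)

theory Defs
  imports "HOL-Analysis.Analysis"
begin

section \<open>Finite simple graphs and defective colourings\<close>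

definition simple_graph :: "'v set \<Rightarrow> 'v set set \<Rightarrow> bool" where
  "simple_graph V E \<longleftrightarrow> finite V \<and> (\<forall>e\<in>E. e \<subseteq> V \<and> card e = 2)"

text \<open>The colours are \<open>1, \<dots>, k\<close> with \<open>k = length ds\<close>; the list \<open>ds\<close> is indexed from \<open>0\<close>, so the
  bound for colour \<open>i\<close> is \<open>ds ! (i - 1)\<close>.\<close>

definition defective_coloring ::
    "'v set \<Rightarrow> 'v set set \<Rightarrow> int list \<Rightarrow> ('v \<Rightarrow> nat) \<Rightarrow> bool" where
  "defective_coloring V E ds \<phi> \<longleftrightarrow>
     (\<forall>v\<in>V. \<phi> v \<in> {1..length ds} \<and>
        int (card {u\<in>V. {u, v} \<in> E \<and> \<phi> u = \<phi> v}) \<le> ds ! (\<phi> v - 1))"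


section \<open>Surfaces\<close>

definition surface :: "'a topology \<Rightarrow> bool" where
  "surface M \<longleftrightarrow>
     topspace M \<noteq> {} \<and> compact_space M \<and> connected_space M \<and>
     Hausdorff_space M \<and> second_countable M \<and>
     (\<forall>x\<in>topspace M. \<exists>U (W :: (real^2) set).
        openin M U \<and> x \<in> U \<and> open W \<and>
        subtopology M U homeomorphic_space top_of_set W)"


section \<open>The sphere with handles or cross-caps, and the Euler genus\<close>

text \<open>A cap is a round disc on the unit sphere, given by its centre \<open>p\<close> on the sphere and its
  chordal radius \<open>r\<close>. Handles and cross-caps are attached along the boundary circles of
  pairwise disjoint closed caps whose interiors have been removed.\<close>

definition open_cap :: "real^3 \<Rightarrow> real \<Rightarrow> (real^3) set" where
  "open_cap p r = sphere 0 1 \<inter> ball p r"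

definition closed_cap :: "real^3 \<Rightarrow> real \<Rightarrow> (real^3) set" where
  "closed_cap p r = sphere 0 1 \<inter> cball p r"

definition cap_circle :: "real^3 \<Rightarrow> real \<Rightarrow> (real^3) set" where
  "cap_circle p r = sphere 0 1 \<inter> sphere p r"

text \<open>A chordal radius below \<open>2\<close> means that the closed cap is not the whole sphere.\<close>

definition disjoint_caps :: "nat \<Rightarrow> (nat \<Rightarrow> real^3) \<Rightarrow> (nat \<Rightarrow> real) \<Rightarrow> bool" where
  "disjoint_caps n c r \<longleftrightarrow>
     (\<forall>i<n. norm (c i) = 1 \<and> 0 < r i \<and> r i < 2) \<and>
     disjoint_family_on (\<lambda>i. closed_cap (c i) (r i)) {..<n}"

definition holed_sphere :: "nat \<Rightarrow> (nat \<Rightarrow> real^3) \<Rightarrow> (nat \<Rightarrow> real) \<Rightarrow> (real^3) set" where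
  "holed_sphere n c r = sphere 0 1 - (\<Union>i<n. open_cap (c i) (r i))"

text \<open>\<open>M\<close> is (homeomorphic to) the quotient space of \<open>X\<close> by the equivalence relation \<open>R\<close>.\<close>

definition is_quotient_by :: "'a topology \<Rightarrow> ('a \<Rightarrow> 'a \<Rightarrow> bool) \<Rightarrow> 'b topology \<Rightarrow> bool" where
  "is_quotient_by X R M \<longleftrightarrow>
     (\<exists>f. quotient_map X M f \<and> (\<forall>x\<in>topspace X. \<forall>y\<in>topspace X. f x = f y \<longleftrightarrow> R x y))"

text \<open>For distinct points \<open>p\<close>, \<open>q\<close> of the sphere, the reflection in the plane through the origin
  that exchanges \<open>p\<close> and \<open>q\<close>; it exchanges the caps of equal radius centred there.\<close>

definition mirror :: "real^3 \<Rightarrow> real^3 \<Rightarrow> real^3 \<Rightarrow> real^3" where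
  "mirror p q x = x - (2 * (x \<bullet> (p - q)) / ((p - q) \<bullet> (p - q))) *\<^sub>R (p - q)"

text \<open>Rotation by \<open>\<pi>\<close> about the axis through the unit vector \<open>p\<close>; on every circle of the sphere
  centred at \<open>p\<close> it is the antipodal map of that circle.\<close>

definition half_turn :: "real^3 \<Rightarrow> real^3 \<Rightarrow> real^3" where
  "half_turn p x = (2 * (x \<bullet> p)) *\<^sub>R p - x"

text \<open>The \<open>i\<close>-th handle joins the caps \<open>2 * i\<close> and \<open>2 * i + 1\<close>: their boundary circles, traversed
  in opposite directions, are identified. The reflection reverses the orientation of the
  sphere, hence the result is orientable (a rotation here would give Klein bottle handles).\<close>

definition handle_gluing ::
    "nat \<Rightarrow> (nat \<Rightarrow> real^3) \<Rightarrow> (nat \<Rightarrow> real) \<Rightarrow> real^3 \<Rightarrow> real^3 \<Rightarrow> bool" where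
  "handle_gluing h c r x y \<longleftrightarrow>
     x = y \<or>
     (\<exists>i<h. x \<in> cap_circle (c (2*i)) (r (2*i)) \<union> cap_circle (c (2*i+1)) (r (2*i+1)) \<and>
        y = mirror (c (2*i)) (c (2*i+1)) x)"

definition sphere_with_handles :: "nat \<Rightarrow> 'a topology \<Rightarrow> bool" where
  "sphere_with_handles h M \<longleftrightarrow>
     (\<exists>c r. disjoint_caps (2*h) c r \<and> (\<forall>i<h. r (2*i) = r (2*i+1)) \<and>
        is_quotient_by (top_of_set (holed_sphere (2*h) c r)) (handle_gluing h c r) M)"

text \<open>A cross-cap identifies antipodal points of the boundary circle of one cap.\<close>

definition crosscap_gluing ::
    "nat \<Rightarrow> (nat \<Rightarrow> real^3) \<Rightarrow> (nat \<Rightarrow> real) \<Rightarrow> real^3 \<Rightarrow> real^3 \<Rightarrow> bool" where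
  "crosscap_gluing k c r x y \<longleftrightarrow>
     x = y \<or> (\<exists>i<k. x \<in> cap_circle (c i) (r i) \<and> y = half_turn (c i) x)"

definition sphere_with_crosscaps :: "nat \<Rightarrow> 'a topology \<Rightarrow> bool" where
  "sphere_with_crosscaps k M \<longleftrightarrow>
     (\<exists>c r. disjoint_caps k c r \<and>
        is_quotient_by (top_of_set (holed_sphere k c r)) (crosscap_gluing k c r) M)"

definition has_euler_genus :: "'a topology \<Rightarrow> nat \<Rightarrow> bool" where
  "has_euler_genus M g \<longleftrightarrow>
     (\<exists>h. g = 2 * h \<and> sphere_with_handles h M) \<or>
     (\<exists>k\<ge>1. g = k \<and> sphere_with_crosscaps k M)"


section \<open>Embeddings of graphs\<close>

text \<open>The vertices are distinct points, and the edges are simple arcs that join their end-vertices,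
  whose interiors avoid all vertices and are pairwise disjoint.\<close>

definition graph_embedding ::
    "'v set \<Rightarrow> 'v set set \<Rightarrow> 'a topology \<Rightarrow> ('v \<Rightarrow> 'a) \<Rightarrow> ('v set \<Rightarrow> real \<Rightarrow> 'a) \<Rightarrow> bool" where
  "graph_embedding V E M pos \<gamma> \<longleftrightarrow>
     pos ` V \<subseteq> topspace M \<and> inj_on pos V \<and>
     (\<forall>e\<in>E. pathin M (\<gamma> e) \<and> inj_on (\<gamma> e) {0..1} \<and>
        {\<gamma> e 0, \<gamma> e 1} = pos ` e \<and>
        \<gamma> e ` {0<..<1} \<inter> pos ` V = {}) \<and>
     disjoint_family_on (\<lambda>e. \<gamma> e ` {0<..<1}) E"

definition embeddable :: "'v set \<Rightarrow> 'v set set \<Rightarrow> 'a topology \<Rightarrow> bool" where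
  "embeddable V E M \<longleftrightarrow> (\<exists>pos \<gamma>. graph_embedding V E M pos \<gamma>)"

end

theory Submission
  imports Defs
begin

text \<open>The complete graph on \<open>2 D + 6\<close> vertices has no \<open>(2, D, D)\<close>-colouring, because a colour class of
  defect \<open>d\<close> in a complete graph has at most \<open>d + 1\<close> vertices. The complete graph on \<open>n\<close> vertices is
  drawn on the sphere with \<open>n\<^sup>2\<close> handles, whose Euler genus is \<open>2 n\<^sup>2\<close>, with one handle for each
  ordered pair of vertices: vertex \<open>v\<close> has a block of consecutive caps on the equator and is joined to
  each of them by an arc in the northern hemisphere, and handle \<open>(v, w)\<close> connects a cap of the block
  of \<open>v\<close> to a cap of the block of \<open>w\<close>. Seen from above, the hemisphere is a disc, the caps cut off
  segments of it and the arcs are chords. The same picture gives connectedness of the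
  surface: each half of the holed sphere is the lift of a convex set.\<close>

section \<open>Quotient topologies\<close>

text \<open>Both \<open>sqrt g\<close> for \<open>g = 2 * (n * n)\<close> and the defect that
  defeats a colouring of the complete graph are linear in \<open>n\<close>. A wasteful drawing
  therefore only affects the constant, and every edge can have a handle of its own. The cost lies in
  proving that an explicit quotient is a surface. Hausdorffness and second countability do not pass
  to quotients in general, so both are derived from closedness of the projection. At a gluing circle
  a chart has to join the surroundings of two different holes. This is why there are two levels
  \<open>\<rho>' < \<rho>\<close>: the caps of level \<rho> are removed, while the larger caps of
  level \<rho>' are still pairwise disjoint and leave a collar around each hole. Inversion in the
  circle turns the missing inner side of one collar into a copy of the outer side, which the mirror
  moves to the partner hole. Centres on the equator make every mirror fix the pole \<open>e\<close>.
  It then matches the northernmost points of the two circles of a handle, and these are the points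
  where the halves of an edge end.\<close>

definition final_topology :: "'a topology \<Rightarrow> ('a \<Rightarrow> 'b) \<Rightarrow> 'b topology" where
  "final_topology X f =
     topology (\<lambda>U. U \<subseteq> f ` topspace X \<and> openin X {x \<in> topspace X. f x \<in> U})"

lemma openin_final_topology:
  "openin (final_topology X f) U \<longleftrightarrow>
     U \<subseteq> f ` topspace X \<and> openin X {x \<in> topspace X. f x \<in> U}"
proof -
  have "istopology (\<lambda>U. U \<subseteq> f ` topspace X \<and> openin X {x \<in> topspace X. f x \<in> U})"
    unfolding istopology_def
  proof (rule conjI; intro allI impI)
    fix S T
    assume S: "S \<subseteq> f ` topspace X \<and> openin X {x \<in> topspace X. f x \<in> S}"
      and T: "T \<subseteq> f ` topspace X \<and> openin X {x \<in> topspace X. f x \<in> T}"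
    have "{x \<in> topspace X. f x \<in> S \<inter> T} = {x \<in> topspace X. f x \<in> S} \<inter> {x \<in> topspace X. f x \<in> T}"
      by auto
    then show "S \<inter> T \<subseteq> f ` topspace X \<and> openin X {x \<in> topspace X. f x \<in> S \<inter> T}"
      using S T by auto
  next
    fix K
    assume K: "\<forall>S\<in>K. S \<subseteq> f ` topspace X \<and> openin X {x \<in> topspace X. f x \<in> S}"
    have "{x \<in> topspace X. f x \<in> \<Union>K} = \<Union>((\<lambda>S. {x \<in> topspace X. f x \<in> S}) ` K)"
      by auto
    then show "\<Union>K \<subseteq> f ` topspace X \<and> openin X {x \<in> topspace X. f x \<in> \<Union>K}"
      using K by (auto intro!: openin_Union)
  qed
  then show ?thesis
    by (simp add: final_topology_def topology_inverse')
qed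

lemma topspace_final_topology [simp]: "topspace (final_topology X f) = f ` topspace X"
proof
  show "topspace (final_topology X f) \<subseteq> f ` topspace X"
    using openin_topspace[of "final_topology X f"] unfolding openin_final_topology by blast
  have "{x \<in> topspace X. f x \<in> f ` topspace X} = topspace X"
    by auto
  then have "openin (final_topology X f) (f ` topspace X)"
    by (simp add: openin_final_topology)
  then show "f ` topspace X \<subseteq> topspace (final_topology X f)"
    by (rule openin_subset)
qed

lemma quotient_map_final_topology: "quotient_map X (final_topology X f) f"
  by (auto simp: quotient_map_def openin_final_topology)

text \<open>\<open>V F\<close> consists of the points whose whole fibre lies in
  \<open>\<Union>F\<close>, and it is open because \<open>f\<close> is closed. Fibres are compact,
  so inside the preimage of an open set finitely many basis sets already cover a fibre; the finite
  subfamilies of a countable basis are countable in number.\<close>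

lemma second_countable_continuous_closed_map_image:
  assumes X: "second_countable X" "compact_space X" and Y: "t1_space Y"
    and f: "continuous_map X Y f" "closed_map X Y f" "f ` topspace X = topspace Y"
  shows "second_countable Y"
proof -
  obtain B where B: "countable B" "\<And>V. V \<in> B \<Longrightarrow> openin X V"
    "\<And>U x. openin X U \<Longrightarrow> x \<in> U \<Longrightarrow> \<exists>V\<in>B. x \<in> V \<and> V \<subseteq> U"
    using X by (auto simp: second_countable_def)
  define V where "V F = topspace Y - f ` (topspace X - \<Union>F)" for F
  show ?thesis
    unfolding second_countable_def
  proof (intro exI conjI allI impI ballI)
    show "countable (V ` {F. finite F \<and> F \<subseteq> B})"
      using B(1) by (intro countable_image countable_Collect_finite_subset)
    show "openin Y W" if "W \<in> V ` {F. finite F \<and> F \<subseteq> B}" for W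
    proof -
      obtain F where F: "W = V F" "F \<subseteq> B"
        using \<open>W \<in> _\<close> by auto
      then have "openin X (\<Union>F)"
        using B(2) by (intro openin_Union) auto
      then have "closedin Y (f ` (topspace X - \<Union>F))"
        using f(2) by (metis closed_map_def closedin_diff closedin_topspace)
      then show ?thesis
        using F by (auto simp: V_def)
    qed
    fix U y
    assume U: "openin Y U \<and> y \<in> U"
    then have y: "y \<in> topspace Y"
      using openin_subset by blast
    have preU: "openin X {x \<in> topspace X. f x \<in> U}"
      using f(1) U by (simp add: continuous_map)
    have "closedin X {x \<in> topspace X. f x \<in> {y}}"
      using f(1) Y y by (intro closedin_continuous_map_preimage) (auto simp: t1_space_closedin_singleton)
    then have "compactin X {x \<in> topspace X. f x \<in> {y}}"
      using X(2) closedin_compact_space by blast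
    then have "\<exists>F. finite F \<and> F \<subseteq> {W \<in> B. W \<subseteq> {x \<in> topspace X. f x \<in> U}} \<and>
        {x \<in> topspace X. f x \<in> {y}} \<subseteq> \<Union>F"
    proof (rule compactinD)
      show "openin X W" if "W \<in> {W \<in> B. W \<subseteq> {x \<in> topspace X. f x \<in> U}}" for W
        using that B(2) by auto
      show "{x \<in> topspace X. f x \<in> {y}} \<subseteq> \<Union>{W \<in> B. W \<subseteq> {x \<in> topspace X. f x \<in> U}}"
        using B(3)[OF preU] U by fastforce
    qed
    then obtain F where F: "finite F" "F \<subseteq> {W \<in> B. W \<subseteq> {x \<in> topspace X. f x \<in> U}}"
      "{x \<in> topspace X. f x \<in> {y}} \<subseteq> \<Union>F"
      by blast
    show "\<exists>W\<in>V ` {F. finite F \<and> F \<subseteq> B}. y \<in> W \<and> W \<subseteq> U"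
    proof (intro bexI[of _ "V F"] conjI)
      show "V F \<in> V ` {F. finite F \<and> F \<subseteq> B}"
        using F by auto
      show "y \<in> V F"
        using F y by (auto simp: V_def)
      have "z \<in> U" if z: "z \<in> V F" for z
      proof -
        obtain x where "x \<in> topspace X" "f x = z"
          using z f(3) unfolding V_def by (metis Diff_iff imageE)
        with z have "x \<in> \<Union>F"
          by (auto simp: V_def)
        with F(2) \<open>f x = z\<close> show ?thesis
          by auto
      qed
      then show "V F \<subseteq> U"
        by blast
    qed
  qed
qed

lemma t1_space_closed_map_image:
  assumes "t1_space X" "closed_map X Y f" "f ` topspace X = topspace Y"
  shows "t1_space Y"
  unfolding t1_space_closedin_singleton
proof
  fix y assume "y \<in> topspace Y"
  then obtain x where x: "x \<in> topspace X" "y = f x"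
    using assms(3) by auto
  then have "closedin Y (f ` {x})"
    using assms(1,2) by (metis closed_map_def t1_space_closedin_singleton)
  then show "closedin Y {y}"
    using x by simp
qed

text \<open>Stereographic projection from the missed point \<open>b\<close>. The charts of the
  quotient are found as open parts of the sphere, and this turns them into open parts of the
  plane.\<close>

lemma open_in_punctured_sphere_homeomorphic_plane:
  fixes W :: "(real^3) set"
  assumes W: "openin (top_of_set (sphere 0 1)) W" and b: "b \<in> sphere 0 1" "b \<notin> W"
  shows "\<exists>W' :: (real^2) set. open W' \<and> top_of_set W homeomorphic_space top_of_set W'"
proof -
  have "(sphere 0 1 - {b}) homeomorphic (UNIV :: (real^2) set)"
    by (rule homeomorphic_punctured_sphere_affine) (use b in auto)
  then obtain f g where fg: "homeomorphism (sphere 0 1 - {b}) (UNIV :: (real^2) set) f g"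
    unfolding homeomorphic_def by blast
  have sub: "W \<subseteq> sphere 0 1 - {b}"
    using W b openin_imp_subset by blast
  have "openin (top_of_set (sphere 0 1 - {b})) W"
    using W sub by (meson Diff_subset openin_subset_trans)
  then have "openin (top_of_set UNIV) (f ` W)"
    by (rule homeomorphism_imp_open_map[OF fg])
  moreover have "homeomorphism W (f ` W) f g"
    using fg sub by (rule homeomorphism_of_subsets) auto
  then have "homeomorphic_maps (top_of_set W) (top_of_set (f ` W)) f g"
    by (auto simp: homeomorphism_def homeomorphic_maps_def)
  ultimately show ?thesis
    by (metis homeomorphic_space_def open_openin subtopology_UNIV)
qed

text \<open>A continuous map from a compact space to a Hausdorff space is closed, so injectivity
  makes it an embedding of \<open>K\<close> and of every part \<open>W\<close>. It is applied to an
  open collar inside a compact one.\<close>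

lemma compact_injective_imp_homeomorphic_image:
  assumes "compact K" "continuous_map (top_of_set K) Y f" "Hausdorff_space Y" "inj_on f K" "W \<subseteq> K"
  shows "subtopology Y (f ` W) homeomorphic_space top_of_set W"
proof -
  have "homeomorphic_map (top_of_set K) (subtopology Y (f ` K)) f"
    using injective_closed_imp_embedding_map[OF assms(2) continuous_imp_closed_map[OF assms(2)]] assms
    by (simp add: embedding_map_def compact_space_subtopology)
  then have "homeomorphic_map (subtopology (top_of_set K) W)
      (subtopology (subtopology Y (f ` K)) (f ` W)) f"
  proof (rule homeomorphic_map_subtopologies)
    have "f ` K \<subseteq> topspace Y"
      using assms(2) by (auto simp: continuous_map_def)
    then show "f ` (topspace (top_of_set K) \<inter> W) = topspace (subtopology Y (f ` K)) \<inter> f ` W"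
      using assms(5) by auto
  qed
  moreover have "K \<inter> W = W" "f ` K \<inter> f ` W = f ` W"
    using assms(5) by auto
  ultimately have "homeomorphic_map (top_of_set W) (subtopology Y (f ` W)) f"
    by (simp add: subtopology_subtopology)
  then show ?thesis
    using homeomorphic_map_imp_homeomorphic_space homeomorphic_space_sym by blast
qed

section \<open>Mirrors and inversions\<close>

lemma mirror_linear: "linear (mirror p q)"
  by (rule linearI)
    (simp_all add: mirror_def inner_add_left distrib_left add_divide_distrib scaleR_add_left mult.left_commute
      scaleR_right_diff_distrib)

lemma mirror_commute: "mirror p q = mirror q p"
proof
  fix x
  have *: "q - p = - (p - q)"
    by simp
  show "mirror p q x = mirror q p x"
    unfolding mirror_def * by (simp only: inner_minus_left inner_minus_right scaleR_minus_right) simp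
qed

lemma mirror_inner:
  assumes "p \<noteq> q"
  shows "mirror p q x \<bullet> mirror p q y = x \<bullet> y"
proof -
  define d where "d = p - q"
  have "d \<bullet> d \<noteq> 0"
    using assms by (simp add: d_def)
  define k l where "k = 2 * (x \<bullet> d) / (d \<bullet> d)" and "l = 2 * (y \<bullet> d) / (d \<bullet> d)"
  have k: "k * (d \<bullet> d) = 2 * (x \<bullet> d)" and l: "l * (d \<bullet> d) = 2 * (y \<bullet> d)"
    using \<open>d \<bullet> d \<noteq> 0\<close> by (simp_all add: k_def l_def)
  have "mirror p q x \<bullet> mirror p q y = (x - k *\<^sub>R d) \<bullet> (y - l *\<^sub>R d)"
    by (simp add: mirror_def k_def l_def d_def)
  also have "\<dots> = x \<bullet> y - l * (x \<bullet> d) - k * (y \<bullet> d) + k * (l * (d \<bullet> d))"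
    by (simp add: inner_diff_left inner_diff_right inner_commute[of d y] algebra_simps)
  also have "l * (x \<bullet> d) = k * (y \<bullet> d)"
  proof -
    have "l * (2 * (x \<bullet> d)) = k * (2 * (y \<bullet> d))"
      unfolding k[symmetric] l[symmetric] by (rule mult.left_commute)
    then show ?thesis
      by simp
  qed
  also have "k * (l * (d \<bullet> d)) = 2 * (k * (y \<bullet> d))"
    by (simp add: l)
  finally show ?thesis
    by simp
qed

lemma mirror_mirror:
  assumes "p \<noteq> q"
  shows "mirror p q (mirror p q x) = x"
proof -
  define d where "d = p - q"
  have "d \<bullet> d \<noteq> 0"
    using assms by (simp add: d_def)
  define k where "k = 2 * (x \<bullet> d) / (d \<bullet> d)"
  have "2 * ((x - k *\<^sub>R d) \<bullet> d) / (d \<bullet> d) = - k"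
    using \<open>d \<bullet> d \<noteq> 0\<close> by (simp add: k_def inner_diff_left)
  then show ?thesis
    by (simp add: mirror_def k_def d_def)
qed

lemma mirror_swap:
  assumes "p \<noteq> q" "norm p = 1" "norm q = 1"
  shows "mirror p q p = q"
proof -
  have "p \<bullet> p = 1" "q \<bullet> q = 1"
    using assms by (simp_all add: dot_square_norm)
  then have "2 * (p \<bullet> (p - q)) = (p - q) \<bullet> (p - q)"
    by (simp add: inner_diff_left inner_diff_right inner_commute)
  moreover have "(p - q) \<bullet> (p - q) \<noteq> 0"
    using assms by simp
  ultimately show ?thesis
    by (simp add: mirror_def)
qed

text \<open>Inversion in the sphere with centre \<open>u\<close> and squared radius
  \<open>u \<bullet> u - 1\<close>. For \<open>1 < norm u\<close> that sphere meets the unit sphere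
  at right angles, so the unit sphere is mapped to itself, the circle
  \<open>x \<bullet> u = 1\<close> is fixed pointwise and its two sides are exchanged.\<close>

definition inversion :: "'a::real_inner \<Rightarrow> 'a \<Rightarrow> 'a" where
  "inversion u x = u + ((u \<bullet> u - 1) / ((x - u) \<bullet> (x - u))) *\<^sub>R (x - u)"

context
  fixes u x :: "'a::real_inner"
  assumes u: "1 < norm u" and x: "norm x = 1"
begin

lemma inversion_pos: "0 < u \<bullet> u - 1" "0 < (x - u) \<bullet> (x - u)"
proof -
  show "0 < u \<bullet> u - 1"
    using u by (simp add: dot_square_norm one_less_power)
  show "0 < (x - u) \<bullet> (x - u)"
    using u x by auto
qed

lemma inversion_dist: "(x - u) \<bullet> (x - u) = u \<bullet> u - 1 + 2 * (1 - x \<bullet> u)"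
proof -
  have "(x - u) \<bullet> (x - u) = x \<bullet> x - 2 * (x \<bullet> u) + u \<bullet> u"
    by (simp add: inner_diff_left inner_diff_right inner_commute[of u x])
  moreover have "x \<bullet> x = 1"
    using x by (simp only: norm_eq_1)
  ultimately show ?thesis
    by simp
qed

lemma norm_inversion: "norm (inversion u x) = 1"
proof -
  define d where "d = x - u"
  define t where "t = (u \<bullet> u - 1) / (d \<bullet> d)"
  have "d \<bullet> d > 0"
    using inversion_pos by (simp add: d_def)
  then have t: "t * (d \<bullet> d) = u \<bullet> u - 1"
    by (simp add: t_def)
  have dd: "d \<bullet> d = u \<bullet> u - 1 + 2 * (1 - x \<bullet> u)"
    using inversion_dist by (simp add: d_def)
  have ud: "u \<bullet> d = x \<bullet> u - u \<bullet> u"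
    by (simp add: d_def inner_diff_right inner_commute)
  have "inversion u x \<bullet> inversion u x = u \<bullet> u + 2 * t * (u \<bullet> d) + t * (t * (d \<bullet> d))"
    unfolding inversion_def d_def[symmetric] t_def[symmetric]
    by (simp add: inner_add_left inner_add_right inner_commute algebra_simps)
  \<comment> \<open>Only the inner factor of \<open>t * (t * (d \<bullet> d))\<close> is replaced by
    \<open>u \<bullet> u - 1\<close>; the terms with \<open>t\<close> then collect to
    \<open>- t * (d \<bullet> d)\<close>.\<close>
  also have "\<dots> = u \<bullet> u - t * (d \<bullet> d)"
    unfolding t[THEN arg_cong[of _ _ "\<lambda>a. t * a"]] unfolding dd ud by (simp add: algebra_simps)
  also have "\<dots> = 1"
    using t by simp
  finally show ?thesis
    by (simp add: norm_eq_1)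
qed

lemma inversion_inversion: "inversion u (inversion u x) = x"
proof -
  define d where "d = x - u"
  have "d \<bullet> d > 0" "u \<bullet> u - 1 > 0"
    using inversion_pos by (simp_all add: d_def)
  define s where "s = (u \<bullet> u - 1) / (d \<bullet> d)"
  have "s \<noteq> 0" "s * (d \<bullet> d) = u \<bullet> u - 1"
    using \<open>d \<bullet> d > 0\<close> \<open>u \<bullet> u - 1 > 0\<close> by (simp_all add: s_def)
  then have "(u \<bullet> u - 1) / (s * (s * (d \<bullet> d))) * s = 1"
    using \<open>u \<bullet> u - 1 > 0\<close> by simp
  moreover have "inversion u (u + s *\<^sub>R d) = u + ((u \<bullet> u - 1) / (s * (s * (d \<bullet> d))) * s) *\<^sub>R d"
    by (simp add: inversion_def)
  moreover have "inversion u x = u + s *\<^sub>R d"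
    by (simp add: inversion_def s_def d_def)
  ultimately show ?thesis
    by (simp add: d_def)
qed

text \<open>What matters is the sign: \<open>1 - x \<bullet> u\<close> is multiplied by a positive
  factor, so the image lies on the opposite side of the plane through the fixed circle.\<close>

lemma inversion_inner: "inversion u x \<bullet> u - 1 = (u \<bullet> u - 1) * (1 - x \<bullet> u) / ((x - u) \<bullet> (x - u))"
proof -
  define d where "d = x - u"
  have dd: "d \<bullet> d > 0" "d \<bullet> d = u \<bullet> u - 1 + 2 * (1 - x \<bullet> u)"
    using inversion_pos inversion_dist by (simp_all add: d_def)
  have "inversion u x \<bullet> u - 1 = u \<bullet> u - 1 + (u \<bullet> u - 1) / (d \<bullet> d) * (x \<bullet> u - u \<bullet> u)"
    by (simp add: inversion_def d_def inner_add_left inner_diff_left)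
  also have "\<dots> = (u \<bullet> u - 1) * (d \<bullet> d + x \<bullet> u - u \<bullet> u) / (d \<bullet> d)"
    using dd(1) by (simp add: field_simps)
  also have "d \<bullet> d + x \<bullet> u - u \<bullet> u = 1 - x \<bullet> u"
    using dd(2) by simp
  finally show ?thesis
    by (simp add: d_def)
qed

lemma inversion_side:
  "inversion u x \<bullet> u \<ge> 1 \<longleftrightarrow> x \<bullet> u \<le> 1" "inversion u x \<bullet> u \<le> 1 \<longleftrightarrow> x \<bullet> u \<ge> 1"
proof -
  define k where "k = (u \<bullet> u - 1) / ((x - u) \<bullet> (x - u))"
  have k: "k > 0"
    using inversion_pos by (simp add: k_def)
  have e: "inversion u x \<bullet> u - 1 = k * (1 - x \<bullet> u)"
    using inversion_inner by (simp add: k_def)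
  have "inversion u x \<bullet> u \<ge> 1 \<longleftrightarrow> 0 \<le> k * (1 - x \<bullet> u)"
    using e by linarith
  then show "inversion u x \<bullet> u \<ge> 1 \<longleftrightarrow> x \<bullet> u \<le> 1"
    using k by (simp add: zero_le_mult_iff)
  have "inversion u x \<bullet> u \<le> 1 \<longleftrightarrow> k * (1 - x \<bullet> u) \<le> 0"
    using e by linarith
  then show "inversion u x \<bullet> u \<le> 1 \<longleftrightarrow> x \<bullet> u \<ge> 1"
    using k by (simp add: mult_le_0_iff)
qed

lemma inversion_fixed: "x \<bullet> u = 1 \<Longrightarrow> inversion u x = x"
proof -
  assume "x \<bullet> u = 1"
  then have "(x - u) \<bullet> (x - u) = u \<bullet> u - 1"
    by (simp add: inversion_dist)
  then have "(u \<bullet> u - 1) / ((x - u) \<bullet> (x - u)) = 1"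
    using inversion_pos(1) by (metis divide_self order_less_irrefl)
  then show ?thesis
    unfolding inversion_def by (metis add.commute diff_add_cancel scaleR_one)
qed

end

lemma continuous_on_inversion:
  fixes u :: "'a::real_inner"
  assumes "1 < norm u" "S \<subseteq> sphere 0 1"
  shows "continuous_on S (inversion u)"
proof -
  have nz: "\<forall>x\<in>S. (x - u) \<bullet> (x - u) \<noteq> 0"
  proof
    fix x assume "x \<in> S"
    then have "norm x = 1"
      using assms by auto
    then show "(x - u) \<bullet> (x - u) \<noteq> 0"
      using inversion_pos(2)[of u x] assms by simp
  qed
  have d: "continuous_on S (\<lambda>x. x - u)"
    by (intro continuous_intros)
  show ?thesis
    unfolding inversion_def
    by (rule continuous_on_add[OF continuous_on_const continuous_on_scaleR[OF continuous_on_divide[OF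
          continuous_on_const continuous_on_inner[OF d d] nz] d]])
qed

section \<open>The sphere with handles at equatorial caps\<close>

text \<open>On the unit sphere a cap around \<open>c i\<close> is a set
  \<open>\<rho> \<le> x \<bullet> c i\<close>, and a lower level means a larger cap. The assumption
  \<open>sep\<close> says that even the caps of level \<rho>' are disjoint; the zone between the two
  levels is the collar used for charts.\<close>

locale equatorial_caps =
  fixes h :: nat and c :: "nat \<Rightarrow> real^3" and e :: "real^3" and \<rho> \<rho>' :: real
  assumes norm_c: "\<And>i. i < 2 * h \<Longrightarrow> norm (c i) = 1"
    and c_e: "\<And>i. i < 2 * h \<Longrightarrow> c i \<bullet> e = 0"
    and norm_e: "norm e = 1"
    and rho: "0 < \<rho>'" "\<rho>' < \<rho>" "\<rho> < 1"
    and sep: "\<And>i j x. i < 2 * h \<Longrightarrow> j < 2 * h \<Longrightarrow> i \<noteq> j \<Longrightarrow> norm x = 1 \<Longrightarrow>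
                \<rho>' \<le> x \<bullet> c i \<Longrightarrow> x \<bullet> c j < \<rho>'"
begin

text \<open>Unit vectors satisfy \<open>(dist p x)^2 = 2 - 2 * (x \<bullet> p)\<close>, so this
  chordal radius belongs to the level \<rho>.\<close>

definition rad :: real where "rad = sqrt (2 - 2 * \<rho>)"

text \<open>The cap at the other end of the handle. Indexing by caps together with
  \<open>par\<close> treats both ends of a handle alike.\<close>

definition par :: "nat \<Rightarrow> nat" where "par j = (if even j then j + 1 else j - 1)"

definition mir :: "nat \<Rightarrow> real^3 \<Rightarrow> real^3" where "mir j = mirror (c j) (c (par j))"

definition X :: "(real^3) set" where "X = holed_sphere (2 * h) c (\<lambda>_. rad)"

definition R :: "real^3 \<Rightarrow> real^3 \<Rightarrow> bool" where "R = handle_gluing h c (\<lambda>_. rad)"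

definition proj :: "real^3 \<Rightarrow> (real^3) set" where "proj x = Collect (R x)"

definition M :: "(real^3) set topology" where "M = final_topology (top_of_set X) proj"

lemma par_par [simp]: "par (par j) = j"
  unfolding par_def by presburger

lemma par_neq [simp]: "par j \<noteq> j" "j \<noteq> par j"
  unfolding par_def by presburger+

lemma par_less [simp]: "j < 2 * h \<Longrightarrow> par j < 2 * h"
  unfolding par_def by presburger

lemma rad_bounds: "0 < rad" "rad < 2" "rad\<^sup>2 = 2 - 2 * \<rho>"
proof -
  show "0 < rad" "rad\<^sup>2 = 2 - 2 * \<rho>"
    using rho by (simp_all add: rad_def)
  have "rad < sqrt 4"
    unfolding rad_def using rho by (intro real_sqrt_less_mono) auto
  then show "rad < 2"
    by simp
qed

lemma cap_iff:
  assumes "norm p = 1" "norm x = 1"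
  shows "dist p x < rad \<longleftrightarrow> \<rho> < x \<bullet> p" "dist p x \<le> rad \<longleftrightarrow> \<rho> \<le> x \<bullet> p" "dist p x = rad \<longleftrightarrow> x \<bullet> p = \<rho>"
proof -
  have "(dist p x)\<^sup>2 = 2 - 2 * (x \<bullet> p)"
    using assms unfolding dist_norm power2_norm_eq_inner
    by (simp add: inner_diff_left inner_diff_right inner_commute norm_eq_1)
  then have "dist p x = sqrt (2 - 2 * (x \<bullet> p))"
    by (metis real_sqrt_unique zero_le_dist)
  then show "dist p x < rad \<longleftrightarrow> \<rho> < x \<bullet> p" "dist p x \<le> rad \<longleftrightarrow> \<rho> \<le> x \<bullet> p" "dist p x = rad \<longleftrightarrow> x \<bullet> p = \<rho>"
    by (auto simp: rad_def)
qed

lemma X_eq: "X = {x. norm x = 1 \<and> (\<forall>i<2*h. x \<bullet> c i \<le> \<rho>)}"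
proof -
  have "x \<notin> open_cap (c i) rad \<longleftrightarrow> x \<bullet> c i \<le> \<rho>" if "norm x = 1" "i < 2 * h" for x i
    using cap_iff(1)[OF norm_c that(1)] that by (auto simp: open_cap_def)
  then show ?thesis
    by (auto simp: X_def holed_sphere_def)
qed

lemma c_neq: "i < 2 * h \<Longrightarrow> j < 2 * h \<Longrightarrow> i \<noteq> j \<Longrightarrow> c i \<noteq> c j"
  using sep[of i j "c i"] norm_c[of i] rho norm_eq_1[of "c i"] by auto

lemma disjoint_caps: "disjoint_caps (2 * h) c (\<lambda>_. rad)"
  unfolding disjoint_caps_def
proof
  show "\<forall>i<2*h. norm (c i) = 1 \<and> 0 < rad \<and> rad < 2"
    using rad_bounds norm_c by auto
  show "disjoint_family_on (\<lambda>i. closed_cap (c i) rad) {..<2*h}"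
    unfolding disjoint_family_on_def
  proof (intro ballI impI)
    fix i j assume ij: "i \<in> {..<2*h}" "j \<in> {..<2*h}" "i \<noteq> j"
    have "False" if "norm x = 1" "dist (c i) x \<le> rad" "dist (c j) x \<le> rad" for x
    proof -
      have "\<rho> \<le> x \<bullet> c i" "\<rho> \<le> x \<bullet> c j"
        using that cap_iff(2)[OF norm_c] ij by auto
      then show False
        using sep[of i j x] ij that rho by auto
    qed
    then show "closed_cap (c i) rad \<inter> closed_cap (c j) rad = {}"
      by (auto simp: closed_cap_def)
  qed
qed

section \<open>Handle mirrors and the gluing relation\<close>

lemma mir_linear: "linear (mir j)"
  by (simp add: mir_def mirror_linear)

lemma mir_par: "mir (par j) = mir j"
  by (simp add: mir_def mirror_commute)

context
  fixes j assumes j: "j < 2 * h"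
begin

lemma mir_inner: "mir j x \<bullet> mir j y = x \<bullet> y"
  using j c_neq by (simp add: mir_def mirror_inner)

lemma mir_mir [simp]: "mir j (mir j x) = x"
  using j c_neq by (simp add: mir_def mirror_mirror)

lemma norm_mir [simp]: "norm (mir j x) = norm x"
  by (metis mir_inner norm_eq_sqrt_inner)

lemma mir_c: "mir j (c j) = c (par j)"
  using j c_neq norm_c by (simp add: mir_def mirror_swap)

lemma mir_inner_c: "mir j x \<bullet> c (par j) = x \<bullet> c j" "mir j x \<bullet> c j = x \<bullet> c (par j)"
  using mir_inner[of x "c j"] mir_inner[of "mir j x" "c j"] by (simp_all add: mir_c)

lemma mir_e [simp]: "mir j e = e"
  using j c_e by (simp add: mir_def mirror_def inner_diff_right inner_commute)

lemma continuous_on_mir: "continuous_on S (mir j)"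
  by (simp add: linear_continuous_on linear_linear mir_linear)

end

lemma R_iff: "R x y \<longleftrightarrow> x = y \<or> (\<exists>j<2*h. norm x = 1 \<and> x \<bullet> c j = \<rho> \<and> y = mir j x)"
proof -
  have circ: "x \<in> cap_circle (c j) rad \<longleftrightarrow> norm x = 1 \<and> x \<bullet> c j = \<rho>" if "j < 2 * h" for j
    using cap_iff(3)[OF norm_c[OF that], of x] by (auto simp: cap_circle_def)
  have par: "par (2 * i) = 2 * i + 1" "par (2 * i + 1) = 2 * i" for i
    by (simp_all add: par_def)
  have mir: "mir (2 * i) = mirror (c (2 * i)) (c (2 * i + 1))" "mir (2 * i + 1) = mirror (c (2 * i)) (c (2 * i + 1))" for i
    using mir_par[of "2 * i"] by (simp_all add: mir_def par)
  have "(\<exists>j<2*h. norm x = 1 \<and> x \<bullet> c j = \<rho> \<and> y = mir j x) \<longleftrightarrow>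
    (\<exists>i<h. x \<in> cap_circle (c (2*i)) rad \<union> cap_circle (c (2*i+1)) rad \<and> y = mirror (c (2*i)) (c (2*i+1)) x)"
    (is "?L \<longleftrightarrow> ?R")
  proof
    assume ?L
    then obtain j where j: "j < 2 * h" "norm x = 1" "x \<bullet> c j = \<rho>" "y = mir j x"
      by auto
    define i where "i = j div 2"
    have "i < h"
      using j by (auto simp: i_def)
    have "j = 2 * i \<or> j = 2 * i + 1"
      unfolding i_def by linarith
    then show ?R
      using j circ mir \<open>i < h\<close> by (intro exI[of _ i]) auto
  next
    assume ?R
    then obtain i where i: "i < h" "x \<in> cap_circle (c (2*i)) rad \<union> cap_circle (c (2*i+1)) rad"
      "y = mirror (c (2*i)) (c (2*i+1)) x"
      by auto
    then have "2 * i < 2 * h" "2 * i + 1 < 2 * h"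
      by auto
    then show ?L
      using i circ mir by (metis Un_iff)
  qed
  then show ?thesis
    by (simp add: R_def handle_gluing_def)
qed

lemma circle_unique:
  "i < 2 * h \<Longrightarrow> j < 2 * h \<Longrightarrow> norm x = 1 \<Longrightarrow> x \<bullet> c i = \<rho> \<Longrightarrow> \<rho>' \<le> x \<bullet> c j \<Longrightarrow> i = j"
  using sep[of j i x] rho by fastforce

text \<open>The mirror carries the collar of cap \<open>j\<close> to the collar of its partner.
  Since the enlarged caps are disjoint, the only removed cap that the image could enter is that of
  the partner, and the bound by \<rho> excludes this.\<close>

lemma mir_in_X:
  assumes "j < 2 * h" "norm x = 1" "\<rho>' \<le> x \<bullet> c j" "x \<bullet> c j \<le> \<rho>"
  shows "mir j x \<in> X"
proof -
  have "mir j x \<bullet> c i \<le> \<rho>" if i: "i < 2 * h" for i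
  proof (cases "i = par j")
    case True
    then show ?thesis
      using assms by (simp add: mir_inner_c)
  next
    case False
    then show ?thesis
      using sep[of "par j" i "mir j x"] assms i rho by (simp add: mir_inner_c)
  qed
  then show ?thesis
    using assms by (simp add: X_eq)
qed

lemma R_refl: "R x x"
  by (simp add: R_iff)

lemma R_sym: assumes "R x y" shows "R y x"
  using assms unfolding R_iff
proof (elim disjE exE conjE)
  fix j assume j: "j < 2 * h" "norm x = 1" "x \<bullet> c j = \<rho>" "y = mir j x"
  then show "y = x \<or> (\<exists>j<2*h. norm y = 1 \<and> y \<bullet> c j = \<rho> \<and> x = mir j y)"
    by (intro disjI2 exI[of _ "par j"]) (auto simp: mir_inner_c mir_par)
qed auto

text \<open>A point lies on at most one circle. After a gluing along \<open>j\<close> it lies on the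
  circle of \<open>par j\<close>, so a second gluing uses the same mirror and leads back.\<close>

lemma R_trans: assumes "R x y" "R y z" shows "R x z"
proof -
  have "x = z" if "j < 2 * h" "norm x = 1" "x \<bullet> c j = \<rho>" "y = mir j x"
      "i < 2 * h" "norm y = 1" "y \<bullet> c i = \<rho>" "z = mir i y" for i j
  proof -
    have "par j = i"
      using that rho by (intro circle_unique[of "par j" i y]) (auto simp: mir_inner_c)
    then have "mir i = mir j"
      using mir_par by metis
    then show ?thesis
      using that by simp
  qed
  then show ?thesis
    using assms by (auto simp: R_iff)
qed

lemma proj_eq_iff: "proj x = proj y \<longleftrightarrow> R x y"
  unfolding proj_def using R_refl R_sym R_trans by blast

lemma quotient_proj: "quotient_map (top_of_set X) M proj"
  by (simp add: M_def quotient_map_final_topology)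

lemma topspace_M: "topspace M = proj ` X"
  by (simp add: M_def)

lemma openin_M: "openin M U \<longleftrightarrow> U \<subseteq> proj ` X \<and> openin (top_of_set X) {x \<in> X. proj x \<in> U}"
  by (simp add: M_def openin_final_topology)

lemma euler_genus_M: "has_euler_genus M (2 * h)"
  unfolding has_euler_genus_def sphere_with_handles_def is_quotient_by_def
proof (intro disjI1 exI[of _ h] exI[of _ c] exI[of _ "\<lambda>_. rad"] exI[of _ proj] conjI)
  show "quotient_map (top_of_set (holed_sphere (2 * h) c (\<lambda>_. rad))) M proj"
    using quotient_proj by (simp add: X_def)
qed (auto simp: disjoint_caps proj_eq_iff R_def)

section \<open>Compactness and separation of the quotient\<close>

lemma closed_X: "closed X"
proof -
  have "X = sphere 0 1 \<inter> (\<Inter>i\<in>{..<2*h}. {x. c i \<bullet> x \<le> \<rho>})"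
    by (auto simp: X_eq inner_commute)
  then show ?thesis
    by (simp add: closed_Int closed_INT closed_halfspace_le)
qed

lemma compact_X: "compact X"
proof -
  have "X \<subseteq> cball 0 1"
    by (auto simp: X_eq)
  then show ?thesis
    using closed_X bounded_subset bounded_cball compact_eq_bounded_closed by blast
qed

lemma continuous_map_proj: "continuous_map (top_of_set X) M proj"
  using quotient_proj by (rule quotient_imp_continuous_map)

text \<open>The saturation of a closed set \<open>T\<close> adds only the mirror images of its
  intersections with finitely many circles. All these pieces are compact.\<close>

lemma closed_map_proj: "closed_map (top_of_set X) M proj"
  unfolding closed_map_def
proof (intro allI impI)
  fix T assume T: "closedin (top_of_set X) T"
  then have TX: "T \<subseteq> X" and cT: "compact T"
    using closedin_imp_subset closedin_compact compact_X by blast+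
  have eq: "{x \<in> X. proj x \<in> proj ` T} = T \<union> (\<Union>j\<in>{..<2*h}. mir j ` (T \<inter> {x. c j \<bullet> x = \<rho>}))"
    (is "?A = ?B")
  proof
    show "?A \<subseteq> ?B"
    proof
      fix x assume "x \<in> ?A"
      then obtain y where "y \<in> T" "R y x"
        using R_sym by (auto simp: proj_eq_iff)
      then show "x \<in> ?B"
        by (auto simp: R_iff inner_commute)
    qed
    show "?B \<subseteq> ?A"
    proof
      fix x assume "x \<in> ?B"
      then consider "x \<in> T" | j y where "j < 2 * h" "y \<in> T" "y \<bullet> c j = \<rho>" "x = mir j y"
        by (auto simp: inner_commute)
      then show "x \<in> ?A"
      proof cases
        case 1
        then show ?thesis using TX by auto
      next
        case (2 j y)
        then have "norm y = 1"
          using TX by (auto simp: X_eq)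
        with 2 have "R y x"
          by (auto simp: R_iff)
        then have "proj x = proj y"
          by (simp add: proj_eq_iff R_sym)
        moreover have "x \<in> X"
          using 2 \<open>norm y = 1\<close> rho mir_in_X by simp
        ultimately show ?thesis
          using 2 by auto
      qed
    qed
  qed
  have "compact ?B"
  proof (intro compact_Un cT compact_UN)
    fix j assume "j \<in> {..<2*h}"
    then show "compact (mir j ` (T \<inter> {x. c j \<bullet> x = \<rho>}))"
      by (intro compact_continuous_image continuous_on_mir compact_Int_closed cT closed_hyperplane) auto
  qed simp
  then have "closedin (top_of_set X) {x \<in> X. proj x \<in> proj ` T}"
    unfolding eq[symmetric] by (simp add: closed_subset compact_imp_closed)
  then show "closedin M (proj ` T)"
    using quotient_proj TX unfolding quotient_map_closedin
    by (simp add: topspace_M image_mono)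
qed

lemma t1_M: "t1_space M"
  by (rule t1_space_closed_map_image[OF _ closed_map_proj])
    (simp_all add: topspace_M Hausdorff_imp_t1_space Hausdorff_space_subtopology)

text \<open>The detour through normality is needed to transport separation: normal spaces are
  preserved by continuous closed surjections, and normal with T1 gives Hausdorff.\<close>

lemma Hausdorff_M: "Hausdorff_space M"
proof (rule normal_t1_imp_Hausdorff_space[OF _ t1_M])
  show "normal_space M"
  proof (rule normal_space_continuous_closed_map_image[OF _ continuous_map_proj closed_map_proj])
    show "normal_space (top_of_set X)"
      by (simp add: compact_Hausdorff_or_regular_imp_normal_space compact_space_subtopology compact_X
          Hausdorff_space_subtopology)
  qed (simp add: topspace_M)
qed

lemma second_countable_M: "second_countable M"
proof (rule second_countable_continuous_closed_map_image[OF _ _ t1_M continuous_map_proj closed_map_proj])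
  obtain B :: "(real^3) set set" where B: "countable B" "\<And>C. C \<in> B \<Longrightarrow> open C"
    "\<And>S. open S \<Longrightarrow> \<exists>U. U \<subseteq> B \<and> S = \<Union>U"
    using univ_second_countable by blast
  have "\<exists>V\<in>B. x \<in> V \<and> V \<subseteq> S" if "open S" "x \<in> S" for S x
    using B(3)[OF that(1)] that(2) by blast
  then have "second_countable (euclidean :: (real^3) topology)"
    unfolding second_countable_def using B(1,2) by (intro exI[of _ B]) auto
  then show "second_countable (top_of_set X)"
    by (rule second_countable_subtopology)
qed (simp_all add: topspace_M compact_space_subtopology compact_X)

lemma compact_M: "compact_space M"
  using image_compactin[OF _ continuous_map_proj, of X] compact_X
  by (simp add: compact_space_def topspace_M compactin_subtopology)

section \<open>The two halves over the equatorial disc, and connectedness\<close>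

definition lift :: "real \<Rightarrow> real^3 \<Rightarrow> real^3" where
  "lift s z = z + (s * sqrt (1 - z \<bullet> z)) *\<^sub>R e"

text \<open>The common shadow of the northern and southern halves of \<open>X\<close>, which are
  recovered by \<open>lift 1\<close> and \<open>lift (-1)\<close>. The centres are orthogonal to
  \<open>e\<close>, so lifting preserves all inner products with them and each cap condition becomes
  a half-plane condition on the shadow.\<close>

definition disc :: "(real^3) set" where
  "disc = {z. z \<bullet> e = 0 \<and> norm z \<le> 1 \<and> (\<forall>i<2*h. z \<bullet> c i \<le> \<rho>)}"

lemma e_e: "e \<bullet> e = 1"
  using norm_e by (simp only: norm_eq_1)

lemma e_c: "i < 2 * h \<Longrightarrow> e \<bullet> c i = 0"
  by (metis c_e inner_commute)

lemma lift_inner_c: "i < 2 * h \<Longrightarrow> lift s z \<bullet> c i = z \<bullet> c i"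
  by (simp add: lift_def inner_add_left e_c)

lemma lift_inner_e: "z \<bullet> e = 0 \<Longrightarrow> lift s z \<bullet> e = s * sqrt (1 - z \<bullet> z)"
  by (simp add: lift_def inner_add_left e_e)

lemma norm_le_1_iff: "norm (z :: real^3) \<le> 1 \<longleftrightarrow> z \<bullet> z \<le> 1"
  by (simp add: norm_le_square)

lemma norm_lift:
  assumes "z \<bullet> e = 0" "norm z \<le> 1" "s\<^sup>2 = 1"
  shows "norm (lift s z) = 1"
proof -
  have "lift s z \<bullet> lift s z = z \<bullet> z + s\<^sup>2 * (sqrt (1 - z \<bullet> z))\<^sup>2"
    using assms(1)
    by (simp add: lift_def inner_add_left inner_add_right inner_commute[of e z] e_e power2_eq_square algebra_simps)
  also have "\<dots> = 1"
    using assms by (simp add: norm_le_1_iff)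
  finally show ?thesis
    by (simp only: norm_eq_1)
qed

lemma lift_in_X: "z \<in> disc \<Longrightarrow> s\<^sup>2 = 1 \<Longrightarrow> lift s z \<in> X"
  by (simp add: disc_def X_eq norm_lift lift_inner_c)

lemma lift_inj: "z \<bullet> e = 0 \<Longrightarrow> w \<bullet> e = 0 \<Longrightarrow> lift s z = lift s w \<Longrightarrow> z = w"
proof -
  assume zw: "z \<bullet> e = 0" "w \<bullet> e = 0" "lift s z = lift s w"
  then have "s * sqrt (1 - z \<bullet> z) = s * sqrt (1 - w \<bullet> w)"
    by (metis lift_inner_e)
  with zw(3) show "z = w"
    unfolding lift_def by simp
qed

lemma continuous_on_lift: "continuous_on S (lift s)"
  unfolding lift_def by (intro continuous_intros)

lemma convex_disc: "convex disc"
proof -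
  have "disc = {z. e \<bullet> z = 0} \<inter> cball 0 1 \<inter> (\<Inter>i\<in>{..<2*h}. {z. c i \<bullet> z \<le> \<rho>})"
    by (auto simp: disc_def inner_commute)
  then show ?thesis
    by (simp add: convex_Int convex_INT convex_halfspace_le convex_hyperplane)
qed

lemma X_subset_lift: "X \<subseteq> lift 1 ` disc \<union> lift (-1) ` disc"
proof
  fix x assume x: "x \<in> X"
  define z where "z = x - (x \<bullet> e) *\<^sub>R e"
  have "x \<bullet> x = 1"
    using x by (simp add: X_eq norm_eq_1)
  then have zz: "z \<bullet> z = 1 - (x \<bullet> e)\<^sup>2"
    by (simp add: z_def inner_diff_left inner_diff_right inner_commute[of e x] e_e power2_eq_square)
  have "z \<in> disc"
    using x zz by (simp add: disc_def norm_le_1_iff X_eq z_def inner_diff_left e_e e_c)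
  moreover have "x = lift 1 z \<or> x = lift (-1) z"
    unfolding lift_def zz by (cases "x \<bullet> e \<ge> 0") (auto simp: z_def)
  ultimately show "x \<in> lift 1 ` disc \<union> lift (-1) ` disc"
    by auto
qed

text \<open>Over a point of norm 1 the lifts \<open>lift 1\<close> and \<open>lift (-1)\<close>
  agree, so such a point of \<open>disc\<close> links the two halves of \<open>X\<close>.\<close>

lemma equator_meets_X:
  assumes "0 < h"
  shows "\<exists>z\<in>disc. norm z = 1"
proof -
  define w where "w = cross3 e (c 0)"
  have c0: "norm (c 0) = 1" "c 0 \<bullet> e = 0" "c 0 \<bullet> c 0 = 1"
    using assms norm_c[of 0] c_e[of 0] by (auto simp: norm_eq_1)
  have w: "w \<bullet> e = 0" "w \<bullet> c 0 = 0"
    by (simp_all add: w_def dot_cross_self)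
  have "(norm w)\<^sup>2 = 1"
    using norm_cross_dot[of e "c 0"] c0 norm_e by (simp add: w_def inner_commute[of e "c 0"])
  then have ww: "w \<bullet> w = 1"
    by (simp add: power2_norm_eq_inner)
  \<comment> \<open>\<open>c 0\<close> and \<open>w\<close> form an orthonormal basis of the
    equatorial plane, and \<open>z\<close> is a point where the circle of cap 0 crosses the equator.
    Separation keeps it out of all other caps.\<close>
  define z where "z = \<rho> *\<^sub>R c 0 + sqrt (1 - \<rho>\<^sup>2) *\<^sub>R w"
  have "\<rho>\<^sup>2 < 1"
    using rho by (simp add: power_less_one_iff)
  have "z \<bullet> z = \<rho> * \<rho> + (sqrt (1 - \<rho>\<^sup>2))\<^sup>2"
    by (simp add: z_def inner_add_left inner_add_right w inner_commute[of "c 0" w] ww c0 power2_eq_square)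
  also have "\<dots> = 1"
    using \<open>\<rho>\<^sup>2 < 1\<close> by (simp add: power2_eq_square)
  finally have nz: "norm z = 1"
    by (simp only: norm_eq_1)
  have z0: "z \<bullet> c 0 = \<rho>"
    by (simp add: z_def inner_add_left w c0)
  have "z \<bullet> c i \<le> \<rho>" if "i < 2 * h" for i
    using sep[of 0 i z] that nz z0 rho assms by (cases "i = 0") auto
  moreover have "z \<bullet> e = 0"
    by (simp add: z_def inner_add_left w c0)
  ultimately show ?thesis
    using nz by (auto simp: disc_def)
qed

lemma connected_X:
  assumes "0 < h"
  shows "connected X"
proof -
  obtain z where z: "z \<in> disc" "norm z = 1"
    using equator_meets_X[OF assms] by blast
  then have "z \<bullet> z = 1"
    by (simp add: norm_eq_1)
  then have "lift 1 z = lift (-1) z"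
    by (simp add: lift_def)
  with z have "lift 1 ` disc \<inter> lift (-1) ` disc \<noteq> {}"
    by blast
  then have "connected (lift 1 ` disc \<union> lift (-1) ` disc)"
    by (intro connected_Un connected_continuous_image continuous_on_lift convex_connected convex_disc)
  moreover have "X = lift 1 ` disc \<union> lift (-1) ` disc"
    using X_subset_lift lift_in_X by auto
  ultimately show ?thesis
    by simp
qed

lemma connected_M:
  assumes "0 < h"
  shows "connected_space M"
  using connected_space_quotient_map_image[OF quotient_proj] connected_X[OF assms]
  by (simp add: connected_space_subtopology)

lemma topspace_M_nonempty:
  assumes "0 < h"
  shows "topspace M \<noteq> {}"
  using equator_meets_X[OF assms] lift_in_X[of _ 1] by (auto simp: topspace_M)

section \<open>Charts off the gluing circles\<close>

lemma chartI:
  fixes W :: "(real^3) set"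
  assumes "openin M V" "v \<in> V" "openin (top_of_set (sphere 0 1)) W" "b \<in> sphere 0 1" "b \<notin> W"
    and "subtopology M V homeomorphic_space top_of_set W"
  shows "\<exists>U (W' :: (real^2) set). openin M U \<and> v \<in> U \<and> open W' \<and>
           subtopology M U homeomorphic_space top_of_set W'"
proof -
  obtain W' :: "(real^2) set" where "open W'" "top_of_set W homeomorphic_space top_of_set W'"
    using open_in_punctured_sphere_homeomorphic_plane[OF assms(3-5)] by blast
  then show ?thesis
    using assms(1,2) homeomorphic_space_trans[OF assms(6)] by blast
qed

lemma interior_chart:
  assumes x: "norm x = 1" "\<And>j. j < 2 * h \<Longrightarrow> x \<bullet> c j < \<rho>"
  shows "\<exists>U (W' :: (real^2) set). openin M U \<and> proj x \<in> U \<and> open W' \<and>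
           subtopology M U homeomorphic_space top_of_set W'"
proof -
  \<comment> \<open>All points off the circles form one set on which the gluing is trivial. The
    antipode of \<open>x\<close> is taken out to leave a centre for stereographic
    projection.\<close>
  define U where "U = {y. norm y = 1 \<and> (\<forall>j<2*h. y \<bullet> c j < \<rho>) \<and> y \<noteq> - x}"
  have UX: "U \<subseteq> X"
    by (simp add: U_def X_eq subset_iff less_imp_le)
  have R: "R y z \<longleftrightarrow> y = z" if "y \<in> U" for y z
  proof -
    have "y \<bullet> c j \<noteq> \<rho>" if "j < 2 * h" for j
      using \<open>y \<in> U\<close> that unfolding U_def by fastforce
    then show ?thesis
      unfolding R_iff by blast
  qed
  have "y \<in> U" if "proj y \<in> proj ` U" for y
  proof -
    from that obtain u where u: "u \<in> U" "proj y = proj u"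
      by blast
    then have "R u y"
      using R_sym by (simp add: proj_eq_iff)
    then show ?thesis
      using R u by simp
  qed
  then have pre: "{y \<in> X. proj y \<in> proj ` U} = U"
    using UX by blast
  have "U = sphere 0 1 \<inter> ((\<Inter>j\<in>{..<2*h}. {y. c j \<bullet> y < \<rho>}) \<inter> - {- x})"
    by (auto simp: U_def inner_commute)
  moreover have "open ((\<Inter>j\<in>{..<2*h}. {y. c j \<bullet> y < \<rho>}) \<inter> - {- x})"
    by (intro open_Int open_INT) (auto simp: open_halfspace_lt)
  ultimately have U: "openin (top_of_set (sphere 0 1)) U"
    by blast
  have "X \<subseteq> sphere 0 1"
    by (auto simp: X_eq)
  then have "openin (top_of_set X) U"
    using U UX openin_subset_trans by blast
  then have V: "openin M (proj ` U)"
    unfolding openin_M pre using UX by auto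
  have "homeomorphic_map (top_of_set U) (subtopology M (proj ` U)) proj"
  proof (rule bijective_closed_imp_homeomorphic_map)
    have sub: "subtopology (top_of_set X) U = top_of_set U"
      using UX by (simp add: subtopology_subtopology Int_absorb1)
    show "closed_map (top_of_set U) (subtopology M (proj ` U)) proj"
      using closed_map_restriction[OF closed_map_proj, of "proj ` U" U] pre sub by simp
    show "continuous_map (top_of_set U) (subtopology M (proj ` U)) proj"
      using continuous_map_from_subtopology[OF continuous_map_proj, of U] sub
      by (simp add: continuous_map_in_subtopology)
    show "proj ` topspace (top_of_set U) = topspace (subtopology M (proj ` U))"
      using UX by (auto simp: topspace_M)
    show "inj_on proj (topspace (top_of_set U))"
      using R by (auto simp: inj_on_def proj_eq_iff)
  qed
  then have "subtopology M (proj ` U) homeomorphic_space top_of_set U"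
    using homeomorphic_map_imp_homeomorphic_space homeomorphic_space_sym by blast
  moreover have "x \<noteq> - x"
  proof
    assume "x = - x"
    then have "x \<bullet> x = - (x \<bullet> x)"
      by (metis inner_minus_right)
    moreover have "x \<bullet> x = 1"
      using x(1) by (simp only: norm_eq_1)
    ultimately show False
      by simp
  qed
  then have "proj x \<in> proj ` U"
    using x by (auto simp: U_def)
  ultimately show ?thesis
    using V U x by (intro chartI[of "proj ` U" _ U "- x"]) (auto simp: U_def)
qed

section \<open>Charts across a gluing circle\<close>

context
  fixes j assumes j: "j < 2 * h"
begin

text \<open>With this centre the fixed circle \<open>x \<bullet> u = 1\<close> of the inversion
  becomes the boundary circle \<open>x \<bullet> c j = \<rho>\<close> of the cap.\<close>

definition cap_inv :: "real^3 \<Rightarrow> real^3" where "cap_inv = inversion ((1 / \<rho>) *\<^sub>R c j)"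

text \<open>A chart around the circle \<open>j\<close>: outside the cap it is the projection; inside the cap, the
  inversion in the circle first moves the point out, and the mirror then carries it to the collar of
  the partner cap.\<close>

definition unfold :: "real^3 \<Rightarrow> (real^3) set" where
  "unfold w = (if w \<bullet> c j \<le> \<rho> then proj w else proj (mir j (cap_inv w)))"

lemma inv_centre: "1 < norm ((1 / \<rho>) *\<^sub>R c j)"
  using rho norm_c[OF j] by simp

lemma norm_inv: "norm w = 1 \<Longrightarrow> norm (cap_inv w) = 1"
  unfolding cap_inv_def by (rule norm_inversion[OF inv_centre])

lemma inv_inv: "norm w = 1 \<Longrightarrow> cap_inv (cap_inv w) = w"
  unfolding cap_inv_def by (rule inversion_inversion[OF inv_centre])

lemma inv_side:
  assumes "norm w = 1"
  shows "\<rho> \<le> cap_inv w \<bullet> c j \<longleftrightarrow> w \<bullet> c j \<le> \<rho>" "cap_inv w \<bullet> c j \<le> \<rho> \<longleftrightarrow> \<rho> \<le> w \<bullet> c j"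
  using inversion_side[OF inv_centre assms] rho by (simp_all add: cap_inv_def field_simps)

lemma inv_fixed: "norm w = 1 \<Longrightarrow> w \<bullet> c j = \<rho> \<Longrightarrow> cap_inv w = w"
  using inversion_fixed[OF inv_centre, of w] rho by (simp add: cap_inv_def)

lemma continuous_on_inv: "S \<subseteq> sphere 0 1 \<Longrightarrow> continuous_on S cap_inv"
  unfolding cap_inv_def by (rule continuous_on_inversion[OF inv_centre])

text \<open>The condition on \<open>cap_inv w\<close> limits how deep \<open>w\<close> may lie
  inside the cap, so that after inversion it is still in the enlarged cap. The closed version is
  compact and serves to prove an embedding; the open version below is the chart domain.\<close>

definition closed_collar :: "(real^3) set" where
  "closed_collar = {w. norm w = 1 \<and> \<rho>' \<le> w \<bullet> c j \<and> \<rho>' \<le> cap_inv w \<bullet> c j}"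

definition open_collar :: "(real^3) set" where
  "open_collar = {w. norm w = 1 \<and> \<rho>' < w \<bullet> c j \<and> \<rho>' < cap_inv w \<bullet> c j}"

lemma compact_closed_collar: "compact closed_collar"
proof -
  have "continuous_on (sphere 0 1) (\<lambda>w. cap_inv w \<bullet> c j)"
    by (intro continuous_intros continuous_on_inv) auto
  then have "closed (sphere 0 1 \<inter> (\<lambda>w. cap_inv w \<bullet> c j) -` {\<rho>'..})"
    by (intro continuous_closed_preimage) auto
  moreover have "closed {w. \<rho>' \<le> c j \<bullet> w}"
    using closed_halfspace_ge[of \<rho>' "c j"] by simp
  ultimately have "compact (sphere 0 1 \<inter> ((sphere 0 1 \<inter> (\<lambda>w. cap_inv w \<bullet> c j) -` {\<rho>'..}) \<inter> {w. \<rho>' \<le> c j \<bullet> w}))"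
    by (metis compact_sphere compact_Int_closed closed_Int)
  also have "sphere 0 1 \<inter> ((sphere 0 1 \<inter> (\<lambda>w. cap_inv w \<bullet> c j) -` {\<rho>'..}) \<inter> {w. \<rho>' \<le> c j \<bullet> w}) = closed_collar"
    by (auto simp: closed_collar_def inner_commute)
  finally show ?thesis .
qed

lemma openin_open_collar: "openin (top_of_set (sphere 0 1)) open_collar"
proof -
  have "continuous_on (sphere 0 1) (\<lambda>w. cap_inv w \<bullet> c j)"
    by (intro continuous_intros continuous_on_inv) auto
  then have "openin (top_of_set (sphere 0 1)) (sphere 0 1 \<inter> (\<lambda>w. cap_inv w \<bullet> c j) -` {\<rho>'<..})"
    by (intro continuous_openin_preimage_gen) auto
  moreover have "openin (top_of_set (sphere 0 1)) (sphere 0 1 \<inter> {w. \<rho>' < c j \<bullet> w})"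
    using open_halfspace_gt[of \<rho>' "c j"] by (intro openin_open_Int) simp
  ultimately have "openin (top_of_set (sphere 0 1))
      ((sphere 0 1 \<inter> (\<lambda>w. cap_inv w \<bullet> c j) -` {\<rho>'<..}) \<inter> (sphere 0 1 \<inter> {w. \<rho>' < c j \<bullet> w}))"
    by (rule openin_Int)
  also have "(sphere 0 1 \<inter> (\<lambda>w. cap_inv w \<bullet> c j) -` {\<rho>'<..}) \<inter> (sphere 0 1 \<inter> {w. \<rho>' < c j \<bullet> w}) = open_collar"
    by (auto simp: open_collar_def inner_commute)
  finally show ?thesis .
qed

lemma in_X: "norm w = 1 \<Longrightarrow> \<rho>' \<le> w \<bullet> c j \<Longrightarrow> w \<bullet> c j \<le> \<rho> \<Longrightarrow> w \<in> X"
proof -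
  assume w: "norm w = 1" "\<rho>' \<le> w \<bullet> c j" "w \<bullet> c j \<le> \<rho>"
  have "w \<bullet> c i \<le> \<rho>" if "i < 2 * h" for i
    using sep[OF j that _ w(1,2)] w(3) rho by (cases "i = j") auto
  with w show "w \<in> X"
    by (simp add: X_eq)
qed

lemma continuous_unfold: "continuous_map (top_of_set closed_collar) M unfold"
  unfolding unfold_def
proof (rule continuous_map_cases_le)
  show "continuous_map (top_of_set closed_collar) euclideanreal (\<lambda>w. w \<bullet> c j)"
    by (simp add: continuous_on_inner)
  show "continuous_map (top_of_set closed_collar) euclideanreal (\<lambda>w. \<rho>)"
    by simp
  have "{w \<in> closed_collar. w \<bullet> c j \<le> \<rho>} \<subseteq> X"
    by (auto simp: closed_collar_def in_X)
  then have "continuous_map (top_of_set {w \<in> closed_collar. w \<bullet> c j \<le> \<rho>}) M proj"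
    by (rule continuous_map_from_subtopology_mono[OF continuous_map_proj])
  then show "continuous_map (subtopology (top_of_set closed_collar)
      {w \<in> topspace (top_of_set closed_collar). w \<bullet> c j \<le> \<rho>}) M proj"
    by (simp add: subtopology_subtopology Collect_conj_eq[symmetric] Int_def)
  let ?T = "{w \<in> closed_collar. \<rho> \<le> w \<bullet> c j}"
  have "?T \<subseteq> sphere 0 1"
    by (auto simp: closed_collar_def)
  then have "continuous_on ?T (\<lambda>w. mir j (cap_inv w))"
    using continuous_on_compose[OF continuous_on_inv continuous_on_mir[OF j]] by (simp add: comp_def)
  moreover have "mir j (cap_inv w) \<in> X" if "w \<in> ?T" for w
    using that j inv_side by (auto simp: closed_collar_def norm_inv intro!: mir_in_X)
  ultimately have "continuous_map (top_of_set ?T) (top_of_set X) (\<lambda>w. mir j (cap_inv w))"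
    by auto
  then have "continuous_map (top_of_set ?T) M (proj \<circ> (\<lambda>w. mir j (cap_inv w)))"
    by (rule continuous_map_compose) (rule continuous_map_proj)
  then show "continuous_map (subtopology (top_of_set closed_collar)
      {w \<in> topspace (top_of_set closed_collar). \<rho> \<le> w \<bullet> c j}) M (\<lambda>w. proj (mir j (cap_inv w)))"
    by (simp add: subtopology_subtopology Collect_conj_eq[symmetric] Int_def comp_def)
  \<comment> \<open>On the circle \<open>cap_inv\<close> fixes \<open>w\<close>, and
    \<open>mir j w\<close> is the point glued to \<open>w\<close>.\<close>
  show "proj w = proj (mir j (cap_inv w))"
    if "w \<in> topspace (top_of_set closed_collar)" "w \<bullet> c j = \<rho>" for w
    using that j by (auto simp: closed_collar_def inv_fixed proj_eq_iff R_iff)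
qed

text \<open>A nontrivial gluing moves a point from its circle to the circle of the partner cap,
  hence out of the enlarged cap \<open>i\<close>.\<close>

lemma R_collar:
  assumes i: "i < 2 * h" and x: "norm x = 1" "\<rho>' \<le> x \<bullet> c i" and y: "norm y = 1" "\<rho>' \<le> y \<bullet> c i"
    and "R x y"
  shows "x = y"
proof (rule ccontr)
  assume "x \<noteq> y"
  then obtain k where k: "k < 2 * h" "x \<bullet> c k = \<rho>" "y = mir k x"
    using \<open>R x y\<close> by (auto simp: R_iff)
  then have "k = i"
    using circle_unique[OF k(1) i x(1)] x by simp
  with k have "y \<bullet> c (par i) = \<rho>"
    by (simp add: mir_inner_c)
  then have "par i = i"
    using circle_unique[of "par i" i y] i y by simp
  then show False
    by simp
qed

text \<open>\<open>x\<close> and \<open>mir j z\<close> lie in different enlarged caps, so they can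
  be related only by the gluing along circle \<open>j\<close>, and the mirror is injective.\<close>

lemma R_across:
  assumes x: "norm x = 1" "\<rho>' \<le> x \<bullet> c j" and z: "norm z = 1" "\<rho>' \<le> z \<bullet> c j" and "R x (mir j z)"
  shows "x = z \<and> x \<bullet> c j = \<rho>"
proof -
  have z': "\<rho>' \<le> mir j z \<bullet> c (par j)"
    using z j by (simp add: mir_inner_c)
  have "x \<noteq> mir j z"
    using sep[of "par j" j x] x z' j by auto
  then obtain k where k: "k < 2 * h" "x \<bullet> c k = \<rho>" "mir j z = mir k x"
    using \<open>R x (mir j z)\<close> by (auto simp: R_iff)
  then have "k = j"
    using circle_unique[OF k(1) j x(1)] x by simp
  with k show ?thesis
    using j by (metis mir_mir)
qed

lemma inj_unfold: "inj_on unfold closed_collar"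
proof (rule inj_onI)
  fix w w' assume w: "w \<in> closed_collar" and w': "w' \<in> closed_collar" and eq: "unfold w = unfold w'"
  \<comment> \<open>Points on the two sides of the circle have equal images only if \<open>w\<close>
    is on the circle, where \<open>cap_inv\<close> is the identity.\<close>
  have aux: "w = w'" if "w \<in> closed_collar" "w' \<in> closed_collar" "w \<bullet> c j \<le> \<rho>" "\<not> w' \<bullet> c j \<le> \<rho>"
      "unfold w = unfold w'" for w w'
  proof -
    have "R w (mir j (cap_inv w'))"
      using that by (simp add: unfold_def proj_eq_iff)
    then have "w = cap_inv w' \<and> w \<bullet> c j = \<rho>"
      using that by (intro R_across) (auto simp: closed_collar_def norm_inv)
    moreover have "norm w = 1" "norm w' = 1"
      using that by (simp_all add: closed_collar_def)
    ultimately show ?thesis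
      by (metis inv_fixed inv_inv)
  qed
  show "w = w'"
  proof (cases "w \<bullet> c j \<le> \<rho>")
    case True
    show ?thesis
    proof (cases "w' \<bullet> c j \<le> \<rho>")
      case True
      then have "R w w'"
        using eq \<open>w \<bullet> c j \<le> \<rho>\<close> by (simp add: unfold_def proj_eq_iff)
      then show ?thesis
        using w w' j by (intro R_collar[of j]) (auto simp: closed_collar_def)
    next
      case False
      then show ?thesis
        using aux[OF w w' True _ eq] by simp
    qed
  next
    case False
    show ?thesis
    proof (cases "w' \<bullet> c j \<le> \<rho>")
      case False
      then have "R (mir j (cap_inv w)) (mir j (cap_inv w'))"
        using eq \<open>\<not> w \<bullet> c j \<le> \<rho>\<close> by (simp add: unfold_def proj_eq_iff)
      then have "mir j (cap_inv w) = mir j (cap_inv w')"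
        using w w' j by (intro R_collar[of "par j"]) (auto simp: closed_collar_def norm_inv mir_inner_c)
      then have "cap_inv w = cap_inv w'"
        using j by (metis mir_mir)
      moreover have "norm w = 1" "norm w' = 1"
        using w w' by (simp_all add: closed_collar_def)
      ultimately show ?thesis
        by (metis inv_inv)
    next
      case True
      then show ?thesis
        using aux[OF w' w True False eq[symmetric]] by simp
    qed
  qed
qed

text \<open>Openness in the quotient is tested on the preimage in \<open>X\<close>, which consists
  of the open collars at both ends of the handle.\<close>

lemma preimage_unfold:
  "{x \<in> X. proj x \<in> unfold ` open_collar} = {x \<in> X. \<rho>' < x \<bullet> c j \<or> \<rho>' < x \<bullet> c (par j)}"
    (is "?L = ?R")
proof
  \<comment> \<open>The right-hand set is saturated: a point of it that is glued to another one lies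
    on circle \<open>j\<close> or on that of \<open>par j\<close>, and the mirror exchanges the
    two.\<close>
  have R_stable: "\<rho>' < x \<bullet> c j \<or> \<rho>' < x \<bullet> c (par j)"
    if y: "norm y = 1" "\<rho>' < y \<bullet> c j \<or> \<rho>' < y \<bullet> c (par j)" and "R y x" for x y
  proof (cases "x = y")
    case False
    then obtain k where k: "k < 2 * h" "y \<bullet> c k = \<rho>" "x = mir k y"
      using \<open>R y x\<close> by (auto simp: R_iff)
    have "k = j \<or> k = par j"
      using circle_unique[OF k(1) j y(1)] circle_unique[OF k(1) par_less[OF j] y(1)] y k by auto
    then show ?thesis
      using k rho j mir_inner_c[of k y] by auto
  qed (use y in simp)
  show "?L \<subseteq> ?R"
  proof
    fix x assume "x \<in> ?L"
    then obtain w where x: "x \<in> X" and w: "w \<in> open_collar" "proj x = unfold w"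
      by auto
    show "x \<in> ?R"
    proof (cases "w \<bullet> c j \<le> \<rho>")
      case True
      then have "R w x"
        using w R_sym by (simp add: unfold_def proj_eq_iff)
      then show ?thesis
        using x w R_stable[of w x] by (simp add: open_collar_def)
    next
      case False
      then have "R (mir j (cap_inv w)) x"
        using w R_sym by (simp add: unfold_def proj_eq_iff)
      then show ?thesis
        using x w R_stable[of "mir j (cap_inv w)" x] j by (simp add: open_collar_def norm_inv mir_inner_c)
    qed
  qed
  show "?R \<subseteq> ?L"
  proof
    fix x assume x: "x \<in> ?R"
    then have nx: "norm x = 1" and le: "\<And>i. i < 2 * h \<Longrightarrow> x \<bullet> c i \<le> \<rho>"
      by (auto simp: X_eq)
    show "x \<in> ?L"
    proof (cases "\<rho>' < x \<bullet> c j")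
      case True
      have "\<rho> \<le> cap_inv x \<bullet> c j"
        using inv_side(1)[OF nx] le[OF j] by simp
      then have "x \<in> open_collar"
        using True nx rho by (auto simp: open_collar_def)
      moreover have "unfold x = proj x"
        using le[OF j] by (simp add: unfold_def)
      ultimately show ?thesis
        using x by force
    next
      case False
      \<comment> \<open>Now \<open>x\<close> is in the partner collar. Undoing the two steps of
        \<open>unfold\<close>, it is mirrored back to \<open>y\<close> and then inverted into cap
        \<open>j\<close>.\<close>
      define y where "y = mir j x"
      have ny: "norm y = 1" and y: "\<rho>' < y \<bullet> c j" "y \<bullet> c j \<le> \<rho>"
        using False x nx j le[OF par_less[OF j]] by (auto simp: y_def mir_inner_c)
      have iy: "\<rho> \<le> cap_inv y \<bullet> c j"
        using inv_side(1)[OF ny] y by simp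
      have "cap_inv y \<in> open_collar"
        using y iy ny rho by (auto simp: open_collar_def norm_inv inv_inv)
      moreover have "unfold (cap_inv y) = proj x"
      proof (cases "cap_inv y \<bullet> c j \<le> \<rho>")
        \<comment> \<open>Here \<open>x\<close> lies on the partner circle, so \<open>unfold\<close>
          takes its first branch and yields \<open>proj y\<close>, where \<open>y\<close> is glued
          to \<open>x\<close>.\<close>
        case True
        with iy have "y \<bullet> c j = \<rho>"
          using inv_side(2)[OF ny] y by simp
        then have "cap_inv y = y" "R y x"
          using ny j by (auto simp: inv_fixed R_iff y_def)
        then show ?thesis
          using y by (simp add: unfold_def proj_eq_iff)
      next
        case False
        then show ?thesis
          using ny j by (simp add: unfold_def inv_inv y_def)
      qed
      ultimately show ?thesis
        using x by force
    qed
  qed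
qed

lemma circle_chart:
  assumes x: "x \<in> X" "x \<bullet> c j = \<rho>"
  shows "\<exists>U (W' :: (real^2) set). openin M U \<and> proj x \<in> U \<and> open W' \<and>
           subtopology M U homeomorphic_space top_of_set W'"
proof (rule chartI[OF _ _ openin_open_collar])
  have sub: "open_collar \<subseteq> closed_collar"
    by (auto simp: open_collar_def closed_collar_def)
  then have "unfold ` open_collar \<subseteq> proj ` X"
    using continuous_unfold by (auto simp: continuous_map_def topspace_M)
  moreover have "openin (top_of_set X) (X \<inter> ({x. \<rho>' < c j \<bullet> x} \<union> {x. \<rho>' < c (par j) \<bullet> x}))"
    using open_halfspace_gt[of \<rho>' "c j"] open_halfspace_gt[of \<rho>' "c (par j)"]
    by (intro openin_open_Int open_Un) auto
  moreover have "X \<inter> ({x. \<rho>' < c j \<bullet> x} \<union> {x. \<rho>' < c (par j) \<bullet> x}) =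
      {x \<in> X. \<rho>' < x \<bullet> c j \<or> \<rho>' < x \<bullet> c (par j)}"
    by (auto simp: inner_commute)
  ultimately show "openin M (unfold ` open_collar)"
    unfolding openin_M preimage_unfold by simp
  have "x \<in> {x \<in> X. proj x \<in> unfold ` open_collar}"
    unfolding preimage_unfold using x rho by simp
  then show "proj x \<in> unfold ` open_collar"
    by simp
  show "- c j \<in> sphere 0 1"
    using norm_c[OF j] by simp
  show "- c j \<notin> open_collar"
  proof
    assume "- c j \<in> open_collar"
    then have "\<rho>' < - (c j \<bullet> c j)"
      by (simp add: open_collar_def)
    moreover have "0 \<le> c j \<bullet> c j"
      by simp
    ultimately show False
      using rho by linarith
  qed
  show "subtopology M (unfold ` open_collar) homeomorphic_space top_of_set open_collar"
    by (rule compact_injective_imp_homeomorphic_image[OF compact_closed_collar continuous_unfold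
          Hausdorff_M inj_unfold sub])
qed

end

theorem surface_M:
  assumes "0 < h"
  shows "surface M"
  unfolding surface_def
proof (intro conjI ballI)
  fix v assume "v \<in> topspace M"
  then obtain x where x: "x \<in> X" "v = proj x"
    by (auto simp: topspace_M)
  show "\<exists>U (W :: (real^2) set). openin M U \<and> v \<in> U \<and> open W \<and>
          subtopology M U homeomorphic_space top_of_set W"
  proof (cases "\<exists>j<2*h. x \<bullet> c j = \<rho>")
    case True
    then show ?thesis
      using circle_chart x by blast
  next
    case False
    then have "x \<bullet> c j < \<rho>" if "j < 2 * h" for j
    proof -
      have "x \<bullet> c j \<le> \<rho>" "x \<bullet> c j \<noteq> \<rho>"
        using x that False by (simp_all add: X_eq)
      then show ?thesis
        by simp
    qed
    then show ?thesis
      using interior_chart[of x] x by (simp add: X_eq)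
  qed
qed (use assms topspace_M_nonempty[OF assms] in \<open>simp_all add: compact_M connected_M Hausdorff_M second_countable_M\<close>)

end

section \<open>Complete graphs\<close>

definition complete_edges :: "nat \<Rightarrow> nat set set" where
  "complete_edges n = {e. e \<subseteq> {..<n} \<and> card e = 2}"

lemma simple_graph_complete: "simple_graph {..<n} (complete_edges n)"
  by (auto simp: simple_graph_def complete_edges_def)

lemma complete_edgesE:
  assumes "e \<in> complete_edges n"
  obtains v w where "v < w" "w < n" "e = {v, w}"
proof -
  obtain x y where xy: "e = {x, y}" "x \<noteq> y" "x < n" "y < n"
    using assms by (auto simp: complete_edges_def card_2_iff)
  show thesis
  proof (cases "x < y")
    case True
    then show thesis
      using that[of x y] xy by simp
  next
    case False
    then show thesis
      using that[of y x] xy by (simp add: insert_commute)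
  qed
qed

lemma pair_in_complete_edges: "{u, v} \<in> complete_edges n \<longleftrightarrow> u < n \<and> v < n \<and> u \<noteq> v"
  by (auto simp: complete_edges_def card_2_iff)

lemma complete_graph_not_defective_colorable:
  fixes D :: int
  assumes "0 \<le> D" "2 * D + 6 \<le> int n"
  shows "\<not> defective_coloring {..<n} (complete_edges n) [2, D, D] \<phi>"
proof
  assume *: "defective_coloring {..<n} (complete_edges n) [2, D, D] \<phi>"
  define C where "C i = {u \<in> {..<n}. \<phi> u = i}" for i
  have fin: "finite (C i)" for i
    by (simp add: C_def)
  have bound: "int (card (C i)) \<le> [2, D, D] ! (i - 1) + 1" if "0 \<le> [2, D, D] ! (i - 1)" for i
  proof (cases "C i = {}")
    case True
    then show ?thesis
      using that by simp
  next
    case False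
    then obtain v where v: "v < n" "\<phi> v = i"
      by (auto simp: C_def)
    have "{u \<in> {..<n}. {u, v} \<in> complete_edges n \<and> \<phi> u = \<phi> v} = C i - {v}"
      using v by (auto simp: C_def pair_in_complete_edges)
    moreover have "int (card {u \<in> {..<n}. {u, v} \<in> complete_edges n \<and> \<phi> u = \<phi> v}) \<le> [2, D, D] ! (i - 1)"
      using * v unfolding defective_coloring_def by blast
    ultimately have "int (card (C i - {v})) \<le> [2, D, D] ! (i - 1)"
      by simp
    moreover have "card (C i) = Suc (card (C i - {v}))"
      using v fin by (intro card.remove) (auto simp: C_def)
    ultimately show ?thesis
      by simp
  qed
  have "{..<n} \<subseteq> C 1 \<union> C 2 \<union> C 3"
  proof
    fix v assume "v \<in> {..<n}"
    then have "\<phi> v \<in> {1..3}"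
      using * by (force simp: defective_coloring_def)
    then have "\<phi> v = 1 \<or> \<phi> v = 2 \<or> \<phi> v = 3"
      by auto
    then show "v \<in> C 1 \<union> C 2 \<union> C 3"
      using \<open>v \<in> {..<n}\<close> by (auto simp: C_def)
  qed
  then have "card {..<n} \<le> card (C 1 \<union> C 2 \<union> C 3)"
    by (intro card_mono) (auto simp: fin)
  also have "\<dots> \<le> card (C 1) + card (C 2) + card (C 3)"
    using card_Un_le[of "C 1 \<union> C 2" "C 3"] card_Un_le[of "C 1" "C 2"] by linarith
  finally have "int n \<le> int (card (C 1)) + int (card (C 2)) + int (card (C 3))"
    by simp
  \<comment> \<open>The three classes have at most 3, \<open>D + 1\<close> and \<open>D + 1\<close>
    vertices, one vertex short of \<open>2 * D + 6\<close>.\<close>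
  then show False
    using bound[of 1] bound[of 2] bound[of 3] assms by (simp add: numeral_3_eq_3)
qed

text \<open>Assembles edges from half-edges in an arbitrary space: \<open>Q j\<close> leads from the
  vertex \<open>blk j\<close> to end \<open>j\<close> of a handle, and the two ends of a handle
  coincide in the space. The edge joining \<open>v < w\<close> uses handle \<open>v * n + w\<close>,
  whose ends belong to the blocks of \<open>v\<close> and \<open>w\<close>.\<close>

lemma complete_graph_embeddable:
  fixes Q :: "nat \<Rightarrow> real \<Rightarrow> 'a" and pos :: "nat \<Rightarrow> 'a" and blk :: "nat \<Rightarrow> nat"
  assumes path: "\<And>j. j < 2 * (n * n) \<Longrightarrow> pathin T (Q j)"
    and start: "\<And>j. j < 2 * (n * n) \<Longrightarrow> Q j 0 = pos (blk j)"
    and glue: "\<And>i. i < n * n \<Longrightarrow> Q (2 * i) 1 = Q (2 * i + 1) 1"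
    and disj: "\<And>j k s t. j < 2 * (n * n) \<Longrightarrow> k < 2 * (n * n) \<Longrightarrow> 0 < s \<Longrightarrow> s \<le> 1 \<Longrightarrow> 0 < t \<Longrightarrow> t \<le> 1 \<Longrightarrow>
        Q j s = Q k t \<Longrightarrow> j = k \<and> s = t \<or> j div 2 = k div 2 \<and> s = 1 \<and> t = 1"
    and vert: "\<And>j s v. j < 2 * (n * n) \<Longrightarrow> 0 < s \<Longrightarrow> s \<le> 1 \<Longrightarrow> v < n \<Longrightarrow> Q j s \<noteq> pos v"
    and pos: "inj_on pos {..<n}" "pos ` {..<n} \<subseteq> topspace T"
    and blk: "\<And>v w. v < n \<Longrightarrow> w < n \<Longrightarrow> blk (2 * (v * n + w)) = v"
      "\<And>v w. v < n \<Longrightarrow> w < n \<Longrightarrow> blk (2 * (v * n + w) + 1) = w"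
  shows "embeddable {..<n} (complete_edges n) T"
proof -
  define idx where "idx e = Min e * n + Max e" for e
  \<comment> \<open>Out along the even half-edge and back along the odd one, meeting at
    \<open>t = 1/2\<close> by \<open>glue\<close>.\<close>
  define \<gamma> where "\<gamma> e t = (if t \<le> 1/2 then Q (2 * idx e) (2 * t) else Q (2 * idx e + 1) (2 - 2 * t))" for e t
  have idx: "idx e < n * n" "blk (2 * idx e) = v" "blk (2 * idx e + 1) = w"
    if e: "v < w" "w < n" "e = {v, w}" for e v w
  proof -
    have i: "idx e = v * n + w"
      using e by (simp add: idx_def)
    have "v * n + w < v * n + n"
      using e by simp
    also have "\<dots> = (v + 1) * n"
      by simp
    also have "\<dots> \<le> n * n"
      using e by (intro mult_right_mono) auto
    finally show "idx e < n * n"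
      by (simp add: i)
    show "blk (2 * idx e) = v" "blk (2 * idx e + 1) = w"
      unfolding i by (rule blk; use e in simp)+
  qed
  have idx_inj: "e = e'" if ee: "e \<in> complete_edges n" "e' \<in> complete_edges n" "idx e = idx e'" for e e'
  proof -
    obtain v w where e: "v < w" "w < n" "e = {v, w}"
      using ee(1) by (rule complete_edgesE)
    obtain v' w' where e': "v' < w'" "w' < n" "e' = {v', w'}"
      using ee(2) by (rule complete_edgesE)
    show ?thesis
      using idx[OF e] idx[OF e'] ee(3) e e' by simp
  qed
  \<comment> \<open>Interior points of an edge have a positive parameter on a half-edge of its own
    handle, which is the form required by \<open>disj\<close> and \<open>vert\<close>.\<close>
  have code: "\<exists>k s. \<gamma> e t = Q k s \<and> k < 2 * (n * n) \<and> k div 2 = idx e \<and> 0 < s \<and> s \<le> 1"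
    if e: "e \<in> complete_edges n" and t: "t \<in> {0<..<1}" for e t
  proof -
    obtain v w where vw: "v < w" "w < n" "e = {v, w}"
      using e by (rule complete_edgesE)
    show ?thesis
    proof (cases "t \<le> 1/2")
      case True
      then show ?thesis
        using t idx(1)[OF vw] by (intro exI[of _ "2 * idx e"] exI[of _ "2 * t"]) (auto simp: \<gamma>_def)
    next
      case False
      then show ?thesis
        using t idx(1)[OF vw] by (intro exI[of _ "2 * idx e + 1"] exI[of _ "2 - 2 * t"]) (auto simp: \<gamma>_def)
    qed
  qed
  have "graph_embedding {..<n} (complete_edges n) T pos \<gamma>"
    unfolding graph_embedding_def
  proof (intro conjI ballI)
    fix e assume e: "e \<in> complete_edges n"
    obtain v w where vw: "v < w" "w < n" "e = {v, w}"
      using e by (rule complete_edgesE)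
    define j where "j = 2 * idx e"
    have j: "j < 2 * (n * n)" "j + 1 < 2 * (n * n)" "blk j = v" "blk (j + 1) = w"
      using idx[OF vw] by (simp_all add: j_def)
    have \<gamma>: "\<gamma> e = (\<lambda>t. if t \<le> 1/2 then Q j (2 * t) else Q (j + 1) (2 - 2 * t))"
      by (simp add: \<gamma>_def j_def fun_eq_iff)
    have g: "Q j 1 = Q (j + 1) 1"
      using glue[OF idx(1)[OF vw]] by (simp add: j_def)
    show "pathin T (\<gamma> e)"
      unfolding pathin_def \<gamma>
    proof (rule continuous_map_cases_le)
      have "continuous_map (top_of_set {0..1/2}) (top_of_set {0..1}) (\<lambda>t::real. 2 * t)"
        by (auto intro!: continuous_intros)
      then have "continuous_map (top_of_set {0..1/2}) T (Q j \<circ> (\<lambda>t. 2 * t))"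
        using path[OF j(1)] unfolding pathin_def by (rule continuous_map_compose)
      moreover have "{0..1} \<inter> {t. (0::real) \<le> t \<and> t \<le> 1 \<and> t \<le> 1/2} = {0..1/2}"
        by auto
      ultimately show "continuous_map (subtopology (top_of_set {0..1}) {t \<in> topspace (top_of_set {0..1}). t \<le> 1/2})
          T (\<lambda>t. Q j (2 * t))"
        by (simp add: subtopology_subtopology comp_def)
      have "continuous_map (top_of_set {1/2..1}) (top_of_set {0..1}) (\<lambda>t::real. 2 - 2 * t)"
        by (auto intro!: continuous_intros)
      then have "continuous_map (top_of_set {1/2..1}) T (Q (j + 1) \<circ> (\<lambda>t. 2 - 2 * t))"
        using path[OF j(2)] unfolding pathin_def by (rule continuous_map_compose)
      moreover have "{0..1} \<inter> {t. (0::real) \<le> t \<and> t \<le> 1 \<and> 1/2 \<le> t} = {1/2..1}"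
        by auto
      ultimately show "continuous_map (subtopology (top_of_set {0..1}) {t \<in> topspace (top_of_set {0..1}). 1/2 \<le> t})
          T (\<lambda>t. Q (j + 1) (2 - 2 * t))"
        by (simp add: subtopology_subtopology comp_def)
      show "Q j (2 * t) = Q (j + 1) (2 - 2 * t)" if "t = 1/2" for t
        using g unfolding that by simp
    qed auto
    have ends: "\<gamma> e 0 = pos v" "\<gamma> e 1 = pos w"
      using start[OF j(1)] start[OF j(2)] j by (simp_all add: \<gamma>)
    then show "{\<gamma> e 0, \<gamma> e 1} = pos ` e"
      using vw by simp
    show "\<gamma> e ` {0<..<1} \<inter> pos ` {..<n} = {}"
    proof -
      have "\<gamma> e t \<noteq> pos u" if "t \<in> {0<..<1}" "u < n" for t u
        using code[OF e that(1)] vert[OF _ _ _ that(2)] by metis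
      then show ?thesis
        by blast
    qed
    \<comment> \<open>The two half-edges of an edge start at the distinct vertices \<open>v\<close>
      and \<open>w\<close>, so a start point is met only once.\<close>
    have start_only: "s = 0 \<and> k = k'"
      if "Q k 0 = Q k' s" "k = j \<or> k = j + 1" "k' = j \<or> k' = j + 1" "0 \<le> s" "s \<le> 1" for k k' s
    proof -
      have k: "k < 2 * (n * n)" "k' < 2 * (n * n)" "blk k < n" "blk k' < n"
        using that j vw by auto
      have "s = 0"
        using that vert[OF k(2) _ that(5) k(3)] start[OF k(1)] by force
      then have "pos (blk k) = pos (blk k')"
        using that start k by simp
      then have "blk k = blk k'"
        using pos(1) k by (simp add: inj_on_def)
      then show ?thesis
        using \<open>s = 0\<close> that j vw by auto
    qed
    \<comment> \<open>The exceptional alternative describes the midpoint, which \<gamma> attains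
      only at \<open>t = 1/2\<close>.\<close>
    have same: "k = k' \<and> s = s' \<or> s = 1 \<and> s' = 1"
      if H: "Q k s = Q k' s'" "k = j \<or> k = j + 1" "k' = j \<or> k' = j + 1" "0 \<le> s" "s \<le> 1" "0 \<le> s'" "s' \<le> 1"
      for k k' s s'
    proof -
      have k: "k < 2 * (n * n)" "k' < 2 * (n * n)"
        using H j by auto
      consider "s = 0" | "s' = 0" | "0 < s" "0 < s'"
        using H by linarith
      then show ?thesis
      proof cases
        case 1
        then show ?thesis
          using start_only[of k k' s'] H by simp
      next
        case 2
        then show ?thesis
          using start_only[of k' k s] H by simp
      next
        case 3
        then show ?thesis
          using disj[OF k, of s s'] H by blast
      qed
    qed
    show "inj_on (\<gamma> e) {0..1}"
    proof (rule inj_onI)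
      fix t t' :: real assume t: "t \<in> {0..1}" "t' \<in> {0..1}" and eq: "\<gamma> e t = \<gamma> e t'"
      consider "t \<le> 1/2" "t' \<le> 1/2" | "t \<le> 1/2" "1/2 < t'" | "1/2 < t" "t' \<le> 1/2" | "1/2 < t" "1/2 < t'"
        by linarith
      then show "t = t'"
      proof cases
        case 1
        then show ?thesis
          using t eq same[of j "2 * t" j "2 * t'"] by (auto simp: \<gamma>)
      next
        case 2
        then show ?thesis
          using t eq same[of j "2 * t" "j + 1" "2 - 2 * t'"] by (auto simp: \<gamma>)
      next
        case 3
        then show ?thesis
          using t eq same[of "j + 1" "2 - 2 * t" j "2 * t'"] by (auto simp: \<gamma>)
      next
        case 4
        then show ?thesis
          using t eq same[of "j + 1" "2 - 2 * t" "j + 1" "2 - 2 * t'"] by (auto simp: \<gamma>)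
      qed
    qed
  next
    show "disjoint_family_on (\<lambda>e. \<gamma> e ` {0<..<1}) (complete_edges n)"
      unfolding disjoint_family_on_def
    proof (intro ballI impI)
      fix e e' assume e: "e \<in> complete_edges n" "e' \<in> complete_edges n" "e \<noteq> e'"
      have False if t: "t \<in> {0<..<1}" "t' \<in> {0<..<1}" "\<gamma> e t = \<gamma> e' t'" for t t'
      proof -
        obtain k s where k: "\<gamma> e t = Q k s" "k < 2 * (n * n)" "k div 2 = idx e" "0 < s" "s \<le> 1"
          using code[OF e(1) t(1)] by blast
        obtain k' s' where k': "\<gamma> e' t' = Q k' s'" "k' < 2 * (n * n)" "k' div 2 = idx e'" "0 < s'" "s' \<le> 1"
          using code[OF e(2) t(2)] by blast
        have "Q k s = Q k' s'"
          using t(3) k(1) k'(1) by simp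
        then have "k div 2 = k' div 2"
          using disj[OF k(2) k'(2) k(4,5) k'(4,5)] by blast
        then show False
          using idx_inj[OF e(1,2)] e(3) k(3) k'(3) by simp
      qed
      then show "\<gamma> e ` {0<..<1} \<inter> \<gamma> e' ` {0<..<1} = {}"
        by blast
    qed
  qed (use pos in auto)
  then show ?thesis
    by (auto simp: embeddable_def)
qed

section \<open>Chords of the equator\<close>

text \<open>The rational parametrisation of the equator turns affine functionals into quadratics in the
  parameter, so that points are separated by sign considerations.\<close>

definition equator :: "real \<Rightarrow> real^3" where
  "equator t = vector [(1 - t\<^sup>2) / (1 + t\<^sup>2), 2 * t / (1 + t\<^sup>2), 0]"

text \<open>An affine functional vanishing at \<open>equator a\<close> and \<open>equator b\<close>:
  in the equatorial plane it is the equation of the chord, or of the tangent if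
  \<open>a = b\<close>.\<close>

definition quad :: "real \<Rightarrow> real \<Rightarrow> real^3 \<Rightarrow> real" where
  "quad a b z = (1 - z $ 1) - (a + b) * z $ 2 + a * b * (1 + z $ 1)"

lemma equator_pos: "0 < 1 + t\<^sup>2" for t :: real
  by (rule add_pos_nonneg) simp_all

lemma norm_equator: "norm (equator t) = 1"
proof -
  have "(1 - t\<^sup>2)\<^sup>2 + (2 * t)\<^sup>2 = (1 + t\<^sup>2)\<^sup>2"
    by (simp add: power2_eq_square algebra_simps)
  then have "((1 - t\<^sup>2) / (1 + t\<^sup>2))\<^sup>2 + (2 * t / (1 + t\<^sup>2))\<^sup>2 = 1"
    using equator_pos[of t] by (simp add: power_divide add_divide_distrib[symmetric] del: power_mult_distrib)
  then show ?thesis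
    by (simp add: norm_eq_1 equator_def inner_vec_def sum_3 power2_eq_square)
qed

lemma equator_axis: "equator t \<bullet> axis 3 1 = 0"
  by (simp add: equator_def inner_axis)

lemma quad_equator: "quad a b (equator t) = 2 * (t - a) * (t - b) / (1 + t\<^sup>2)"
proof -
  have *: "1 - (1 - t\<^sup>2) / (1 + t\<^sup>2) = 2 * t\<^sup>2 / (1 + t\<^sup>2)" "1 + (1 - t\<^sup>2) / (1 + t\<^sup>2) = 2 / (1 + t\<^sup>2)"
    using equator_pos[of t] by (simp_all add: divide_simps)
  have "quad a b (equator t) = 2 * t\<^sup>2 / (1 + t\<^sup>2) - (a + b) * (2 * t / (1 + t\<^sup>2)) + a * b * (2 / (1 + t\<^sup>2))"
    by (simp only: quad_def equator_def vector_3 *)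
  also have "\<dots> = (2 * t\<^sup>2 - (a + b) * (2 * t) + a * b * 2) / (1 + t\<^sup>2)"
    by (simp add: add_divide_distrib diff_divide_distrib)
  also have "2 * t\<^sup>2 - (a + b) * (2 * t) + a * b * 2 = 2 * (t - a) * (t - b)"
    by (simp add: power2_eq_square algebra_simps)
  finally show ?thesis .
qed

lemma quad_equator_sign:
  "quad a b (equator t) = 0 \<longleftrightarrow> t = a \<or> t = b"
  "0 < quad a b (equator t) \<longleftrightarrow> 0 < (t - a) * (t - b)"
  "quad a b (equator t) < 0 \<longleftrightarrow> (t - a) * (t - b) < 0"
  using equator_pos[of t] unfolding quad_equator
  by (auto simp: zero_less_divide_iff divide_less_0_iff mult.assoc zero_less_mult_iff mult_less_0_iff)

lemma quad_combination:
  "quad a b ((1 - s) *\<^sub>R x + s *\<^sub>R y) = (1 - s) * quad a b x + s * quad a b y"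
  by (simp add: quad_def algebra_simps)

lemma inj_equator: "inj equator"
proof (rule injI)
  fix s t assume "equator s = equator t"
  then have "quad t t (equator s) = 0"
    using quad_equator_sign(1)[of t t t] by simp
  then show "s = t"
    by (simp add: quad_equator_sign(1))
qed

text \<open>\<open>quad a b\<close> vanishes along the first chord. On the second it vanishes at the
  start, so a further zero at positive \<open>t\<close> makes it vanish at \<open>equator b'\<close>
  too.\<close>

lemma chords_same_start:
  assumes "(1 - s) *\<^sub>R equator a + s *\<^sub>R equator b = (1 - t) *\<^sub>R equator a + t *\<^sub>R equator b'"
    and "0 < t" "b' \<noteq> a"
  shows "b = b'"
proof -
  have "0 = quad a b ((1 - t) *\<^sub>R equator a + t *\<^sub>R equator b')"
  proof -
    have "quad a b (equator a) = 0" "quad a b (equator b) = 0"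
      by (simp_all add: quad_equator_sign)
    then show ?thesis
      unfolding assms(1)[symmetric] quad_combination by simp
  qed
  also have "\<dots> = t * quad a b (equator b')"
    unfolding quad_combination using quad_equator_sign(1)[of a b a] by simp
  finally show ?thesis
    using assms(2,3) quad_equator_sign(1)[of a b b'] by auto
qed

lemma chord_ends:
  assumes "(1 - s) *\<^sub>R equator a + s *\<^sub>R equator b = (1 - t) *\<^sub>R equator a + t *\<^sub>R equator b" "a \<noteq> b"
  shows "s = t"
proof -
  have "(s - t) *\<^sub>R (equator b - equator a) = 0"
    using assms(1) by (simp add: algebra_simps)
  then show ?thesis
    using assms(2) inj_equator by (auto dest: injD)
qed

text \<open>The line through \<open>equator l\<close> and \<open>equator u\<close> separates the
  chords: one has both ends on the arc between \<open>l\<close> and \<open>u\<close>, the other on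
  the complementary arc.\<close>

lemma chords_separated:
  assumes "(1 - s) *\<^sub>R equator a + s *\<^sub>R equator b = (1 - t) *\<^sub>R equator a' + t *\<^sub>R equator b'"
    and "0 \<le> s" "s \<le> 1" "0 \<le> t" "t \<le> 1"
    and "l < a" "a < u" "l < b" "b < u" "a' < l \<or> u < a'" "a' < l \<longleftrightarrow> b' < l" "u < a' \<longleftrightarrow> u < b'" "l < u"
  shows False
proof -
  have "quad l u (equator a) < 0" "quad l u (equator b) < 0"
    using assms by (auto simp: quad_equator_sign mult_less_0_iff)
  then have "(1 - s) * quad l u (equator a) + s * quad l u (equator b) < 0"
    using assms(2,3) by (intro convex_bound_lt[of _ 0 _ "1 - s" s, simplified]) auto
  moreover have "0 < quad l u (equator a')" "0 < quad l u (equator b')"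
    using assms by (auto simp: quad_equator_sign zero_less_mult_iff)
  then have "0 < (1 - t) * quad l u (equator a') + t * quad l u (equator b')"
    using assms(4,5) by (metis add_pos_nonneg add_nonneg_pos diff_ge_0_iff_ge less_eq_real_def mult_nonneg_nonneg mult_pos_pos diff_gt_0_iff_gt zero_less_one)
  ultimately show False
    using arg_cong[OF assms(1), of "quad l u"] unfolding quad_combination by simp
qed

lemma caps_separated:
  fixes p :: "nat \<Rightarrow> 'a::real_inner"
  assumes unit: "\<And>i. i < m \<Longrightarrow> norm (p i) = 1" and inj: "inj_on p {..<m}"
  shows "\<exists>r. 0 < r \<and> r < 1 \<and>
    (\<forall>i j x. i < m \<longrightarrow> j < m \<longrightarrow> i \<noteq> j \<longrightarrow> norm x = 1 \<longrightarrow> r \<le> x \<bullet> p i \<longrightarrow> x \<bullet> p j < r)"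
proof -
  \<comment> \<open>The entry 1 keeps \<open>S\<close> nonempty when there are no pairs and ensures
    \<open>d \<le> 1\<close>, whence \<open>0 < r\<close> below.\<close>
  define S where "S = insert 1 ((\<lambda>(i, j). 1 - p i \<bullet> p j) ` {(i, j). i < m \<and> j < m \<and> i \<noteq> j})"
  have "finite {(i, j). i < m \<and> j < m \<and> i \<noteq> j}"
    by (rule finite_subset[of _ "{..<m} \<times> {..<m}"]) auto
  then have fin: "finite S"
    by (simp add: S_def)
  have lt1: "p i \<bullet> p j < 1" if "i < m" "j < m" "i \<noteq> j" for i j
  proof -
    have "p i \<noteq> p j"
      using inj that by (auto simp: inj_on_def)
    then have "0 < (p i - p j) \<bullet> (p i - p j)"
      by simp
    also have "\<dots> = 2 - 2 * (p i \<bullet> p j)"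
    proof -
      have "p i \<bullet> p i = 1" "p j \<bullet> p j = 1"
        using unit that by (simp_all add: norm_eq_1)
      then show ?thesis
        by (simp add: inner_diff_left inner_diff_right inner_commute[of "p j" "p i"])
    qed
    finally show ?thesis
      by simp
  qed
  define d where "d = Min S"
  have d: "0 < d" "d \<le> 1" "\<And>i j. i < m \<Longrightarrow> j < m \<Longrightarrow> i \<noteq> j \<Longrightarrow> d \<le> 1 - p i \<bullet> p j"
  proof -
    have "\<forall>x\<in>S. 0 < x"
      using lt1 by (auto simp: S_def)
    then show "0 < d"
      unfolding d_def using fin by (subst Min_gr_iff) (auto simp: S_def)
    show "d \<le> 1"
      unfolding d_def using fin by (rule Min_le) (simp add: S_def)
    show "d \<le> 1 - p i \<bullet> p j" if "i < m" "j < m" "i \<noteq> j" for i j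
      unfolding d_def using fin by (rule Min_le) (use that in \<open>force simp: S_def\<close>)
  qed
  \<comment> \<open>A common point of two caps of level \<open>r\<close> would give
    \<open>2 * r \<le> norm (p i + p j)\<close>, whose square is at most \<open>4 - 2 * d\<close>.
    But \<open>(2 * r)^2 = 4 - d + d^2 / 16\<close> is larger.\<close>
  define r where "r = 1 - d / 8"
  have "x \<bullet> p j < r" if ij: "i < m" "j < m" "i \<noteq> j" and x: "norm x = 1" "r \<le> x \<bullet> p i" for i j x
  proof (rule ccontr)
    assume "\<not> x \<bullet> p j < r"
    then have "2 * r \<le> x \<bullet> (p i + p j)"
      using x by (simp add: inner_add_right)
    also have "\<dots> \<le> norm (p i + p j)"
      using norm_cauchy_schwarz[of x "p i + p j"] x by simp
    finally have "(2 * r)\<^sup>2 \<le> (norm (p i + p j))\<^sup>2"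
      using d by (intro power_mono) (auto simp: r_def)
    also have "\<dots> = 2 + 2 * (p i \<bullet> p j)"
    proof -
      have "p i \<bullet> p i = 1" "p j \<bullet> p j = 1"
        using unit ij by (simp_all add: norm_eq_1)
      then show ?thesis
        by (simp add: power2_norm_eq_inner inner_add_left inner_add_right inner_commute[of "p j" "p i"])
    qed
    also have "\<dots> \<le> 4 - 2 * d"
      using d(3)[OF ij] by simp
    also have "\<dots> < (2 * r)\<^sup>2"
      using d(1) by (simp add: r_def power2_eq_square algebra_simps add_pos_pos)
    finally show False
      by simp
  qed
  then show ?thesis
    using d by (intro exI[of _ r]) (auto simp: r_def)
qed

section \<open>Drawing complete graphs\<close>

context equatorial_caps
begin

text \<open>Transfers a plane drawing in \<open>disc\<close> to the surface. The segment
  \<open>q j\<close> ends at \<open>\<rho> * c j\<close>, the midpoint of the chord cut off by cap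
  \<open>j\<close>, which \<open>lift 1\<close> sends to the northernmost point of circle
  \<open>j\<close>.\<close>

lemma embeddable_complete_graph:
  fixes a :: "nat \<Rightarrow> real^3" and blk :: "nat \<Rightarrow> nat" and n :: nat
  defines "q \<equiv> \<lambda>j s. (1 - s) *\<^sub>R a (blk j) + s *\<^sub>R \<rho> *\<^sub>R c j"
  assumes h: "h = n * n"
    and a_e: "\<And>v. v < n \<Longrightarrow> a v \<bullet> e = 0" and a_norm: "\<And>v. v < n \<Longrightarrow> norm (a v) \<le> 1"
    and a_c: "\<And>v j. v < n \<Longrightarrow> j < 2 * h \<Longrightarrow> a v \<bullet> c j < \<rho>"
    and blk: "\<And>v w. v < n \<Longrightarrow> w < n \<Longrightarrow> blk (2 * (v * n + w)) = v"
      "\<And>v w. v < n \<Longrightarrow> w < n \<Longrightarrow> blk (2 * (v * n + w) + 1) = w"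
      "\<And>j. j < 2 * h \<Longrightarrow> blk j < n"
    and disj: "\<And>j k s t. j < 2 * h \<Longrightarrow> k < 2 * h \<Longrightarrow> 0 < s \<Longrightarrow> s \<le> 1 \<Longrightarrow> 0 < t \<Longrightarrow> t \<le> 1 \<Longrightarrow>
        q j s = q k t \<Longrightarrow> j = k \<and> s = t"
    and vert: "\<And>j s v. j < 2 * h \<Longrightarrow> 0 < s \<Longrightarrow> s \<le> 1 \<Longrightarrow> v < n \<Longrightarrow> q j s \<noteq> a v"
    and inj: "inj_on a {..<n}"
  shows "embeddable {..<n} (complete_edges n) M"
proof (rule complete_graph_embeddable)
  define Q where "Q j s = proj (lift 1 (q j s))" for j s
  define pos where "pos v = proj (lift 1 (a v))" for v
  have c_c: "\<rho> * (c j \<bullet> c k) < \<rho>" if "j < 2 * h" "k < 2 * h" "j \<noteq> k" for j k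
  proof -
    have "c j \<bullet> c j = 1"
      using norm_c[OF that(1)] by (simp only: norm_eq_1)
    then have "c j \<bullet> c k < 1"
      using sep[OF that norm_c[OF that(1)]] rho by simp
    then show ?thesis
      using rho by simp
  qed
  have a_disc: "a v \<in> disc" if "v < n" for v
    using that a_e a_norm a_c[OF that] by (simp add: disc_def less_imp_le)
  have c_disc: "\<rho> *\<^sub>R c j \<in> disc" if "j < 2 * h" for j
  proof -
    have "\<rho> * (c j \<bullet> c k) \<le> \<rho>" if "k < 2 * h" for k
    proof (cases "k = j")
      case True
      have "c j \<bullet> c j = 1"
        using norm_c[OF \<open>j < 2 * h\<close>] by (simp only: norm_eq_1)
      with True show ?thesis
        by simp
    next
      case False
      then show ?thesis
        using c_c[OF \<open>j < 2 * h\<close> that] by simp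
    qed
    then show ?thesis
      using that norm_c[OF that] c_e[OF that] rho by (simp add: disc_def)
  qed
  have q_disc: "q j s \<in> disc" if "j < 2 * h" "0 \<le> s" "s \<le> 1" for j s
    unfolding q_def using that
    by (intro convexD[OF convex_disc] a_disc blk(3) c_disc) simp_all
  \<comment> \<open>A half-edge touches a circle only at its own end: its start is strictly below
    level \<rho> for all caps, and its end reaches that level for cap \<open>j\<close>
    alone.\<close>
  have q_c: "j = k \<and> s = 1" if jk: "j < 2 * h" "k < 2 * h" "0 < s" "s \<le> 1" "q j s \<bullet> c k = \<rho>" for j k s
  proof (rule ccontr)
    assume neg: "\<not> (j = k \<and> s = 1)"
    have eq: "q j s \<bullet> c k = (1 - s) * (a (blk j) \<bullet> c k) + s * (\<rho> * (c j \<bullet> c k))"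
      by (simp add: q_def inner_add_left)
    have a1: "a (blk j) \<bullet> c k < \<rho>"
      using a_c[OF blk(3)[OF jk(1)] jk(2)] .
    have c1: "\<rho> * (c j \<bullet> c k) \<le> \<rho>"
      using c_disc[OF jk(1)] jk(2) by (simp add: disc_def)
    have "(1 - s) * (a (blk j) \<bullet> c k) + s * (\<rho> * (c j \<bullet> c k)) < \<rho>"
    proof (cases "s = 1")
      case True
      then show ?thesis
        using c_c[OF jk(1,2)] neg by simp
    next
      case False
      then have "(1 - s) * (a (blk j) \<bullet> c k) < (1 - s) * \<rho>"
        using a1 jk(4) by simp
      moreover have "s * (\<rho> * (c j \<bullet> c k)) \<le> s * \<rho>"
        using c1 jk(3) by simp
      moreover have "(1 - s) * \<rho> + s * \<rho> = \<rho>"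
        by (simp add: algebra_simps)
      ultimately show ?thesis
        by linarith
    qed
    then show False
      using eq jk(5) by simp
  qed
  have disc_e: "z \<bullet> e = 0" if "z \<in> disc" for z
    using that by (simp add: disc_def)
  have q1: "q j 1 = \<rho> *\<^sub>R c j" for j
    by (simp add: q_def)
  \<comment> \<open>The mirror is linear, fixes \<open>e\<close> and exchanges the two centres, so
    it matches the northernmost points of the two circles.\<close>
  have mir_lift: "mir j (lift 1 (q j 1)) = lift 1 (q (par j) 1)" if "j < 2 * h" for j
  proof -
    have "c j \<bullet> c j = 1" "c (par j) \<bullet> c (par j) = 1"
      using norm_c[OF that] norm_c[OF par_less[OF that]] by (simp_all only: norm_eq_1)
    then show ?thesis
      using that unfolding q1 lift_def
      by (simp add: linear_add[OF mir_linear] linear_scale[OF mir_linear] mir_c)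
  qed
  show "pathin M (Q j)" if "j < 2 * (n * n)" for j
  proof -
    have j: "j < 2 * h"
      using that h by simp
    have "continuous_on {0..1} (\<lambda>s. lift 1 (q j s))"
      unfolding q_def lift_def by (intro continuous_intros)
    moreover have "lift 1 (q j s) \<in> X" if "s \<in> {0..1}" for s
      using that q_disc[OF j] by (simp add: lift_in_X)
    ultimately have "continuous_map (top_of_set {0..1}) (top_of_set X) (\<lambda>s. lift 1 (q j s))"
      by auto
    from continuous_map_compose[OF this continuous_map_proj] show ?thesis
      by (simp add: pathin_def Q_def[abs_def] comp_def)
  qed
  show "Q j 0 = pos (blk j)" for j
    by (simp add: Q_def pos_def q_def)
  show "Q (2 * i) 1 = Q (2 * i + 1) 1" if "i < n * n" for i
  proof -
    have i: "2 * i < 2 * h"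
      using that h by simp
    have "par (2 * i) = 2 * i + 1"
      by (simp add: par_def)
    moreover have "norm (lift 1 (q (2 * i) 1)) = 1"
      using lift_in_X[OF q_disc[OF i, of 1], of 1] by (simp add: X_eq)
    moreover have "lift 1 (q (2 * i) 1) \<bullet> c (2 * i) = \<rho>"
    proof -
      have "c (2 * i) \<bullet> c (2 * i) = 1"
        using norm_c[OF i] by (simp only: norm_eq_1)
      then show ?thesis
        using i by (simp add: lift_inner_c q1)
    qed
    ultimately have "R (lift 1 (q (2 * i) 1)) (lift 1 (q (2 * i + 1) 1))"
      unfolding R_iff using i mir_lift[OF i] by metis
    then show ?thesis
      by (simp add: Q_def proj_eq_iff)
  qed
  show "j = k \<and> s = t \<or> j div 2 = k div 2 \<and> s = 1 \<and> t = 1"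
    if jk: "j < 2 * (n * n)" "k < 2 * (n * n)" "0 < s" "s \<le> 1" "0 < t" "t \<le> 1" "Q j s = Q k t" for j k s t
  proof -
    have j: "j < 2 * h" and k: "k < 2 * h"
      using jk h by simp_all
    have e0: "q j s \<bullet> e = 0" "q k t \<bullet> e = 0"
      using q_disc[OF j] q_disc[OF k] jk by (auto intro: disc_e)
    have "R (lift 1 (q j s)) (lift 1 (q k t))"
      using jk(7) by (simp add: Q_def proj_eq_iff)
    then consider "lift 1 (q j s) = lift 1 (q k t)"
      | i where "i < 2 * h" "lift 1 (q j s) \<bullet> c i = \<rho>" "lift 1 (q k t) = mir i (lift 1 (q j s))"
      unfolding R_iff by blast
    then show ?thesis
    proof cases
      case 1
      then have "q j s = q k t"
        using lift_inj e0 by blast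
      then show ?thesis
        using disj[OF j k jk(3-6)] by simp
    next
      \<comment> \<open>A nontrivial gluing forces \<open>s = 1\<close>. The glued point is then the
        end of half-edge \<open>par j\<close>, and disjointness in the plane identifies it with
        \<open>q k t\<close>.\<close>
      case (2 i)
      then have "q j s \<bullet> c i = \<rho>"
        by (simp add: lift_inner_c)
      then have ij: "j = i" "s = 1"
        using q_c[OF j 2(1) jk(3,4)] by simp_all
      then have "lift 1 (q k t) = lift 1 (q (par j) 1)"
        using 2(3) mir_lift[OF j] by simp
      moreover have "q (par j) 1 \<bullet> e = 0"
        using q_disc[OF par_less[OF j], of 1] by (auto intro: disc_e)
      ultimately have "q k t = q (par j) 1"
        using lift_inj e0 by blast
      then have "k = par j \<and> t = 1"
        using disj[OF k par_less[OF j] jk(5,6), of 1] by simp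
      moreover have "par j div 2 = j div 2"
        unfolding par_def by presburger
      ultimately show ?thesis
        using ij by simp
    qed
  qed
  have R_vertex: "R (lift 1 (a v)) y \<longleftrightarrow> y = lift 1 (a v)" if "v < n" for v y
  proof -
    have "lift 1 (a v) \<bullet> c i \<noteq> \<rho>" if "i < 2 * h" for i
      using a_c[OF \<open>v < n\<close> that] by (simp add: lift_inner_c[OF that])
    then show ?thesis
      unfolding R_iff by blast
  qed
  show "Q j s \<noteq> pos v" if "j < 2 * (n * n)" "0 < s" "s \<le> 1" "v < n" for j s v
  proof
    assume "Q j s = pos v"
    then have "R (lift 1 (a v)) (lift 1 (q j s))"
      unfolding Q_def pos_def using proj_eq_iff by metis
    then have eq: "lift 1 (q j s) = lift 1 (a v)"
      using R_vertex that by simp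
    have j: "j < 2 * h"
      using that h by simp
    then have "q j s \<bullet> e = 0"
      using q_disc that by (auto intro: disc_e)
    then have "q j s = a v"
      using eq a_e[OF that(4)] lift_inj by blast
    then show False
      using vert[OF j that(2-4)] by simp
  qed
  show "inj_on pos {..<n}"
  proof (rule inj_onI)
    fix v w assume vw: "v \<in> {..<n}" "w \<in> {..<n}" "pos v = pos w"
    then have "R (lift 1 (a v)) (lift 1 (a w))"
      by (simp add: pos_def proj_eq_iff)
    then have "lift 1 (a w) = lift 1 (a v)"
      using R_vertex vw by simp
    then have "a w = a v"
      using a_e vw lift_inj by blast
    then show "v = w"
      using inj vw by (metis inj_onD)
  qed
  show "pos ` {..<n} \<subseteq> topspace M"
    using a_disc lift_in_X[of _ 1] by (auto simp: pos_def topspace_M)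
qed (use blk in auto)

end

lemma complete_graph_on_surface:
  assumes "0 < n"
  shows "\<exists>M :: (real^3) set topology. surface M \<and> has_euler_genus M (2 * (n * n)) \<and>
           embeddable {..<n} (complete_edges n) M"
proof -
  \<comment> \<open>Handle \<open>j div 2\<close> encodes the pair \<open>(v, w)\<close> as
    \<open>v * n + w\<close>; its even end belongs to \<open>v\<close>, its odd end to
    \<open>w\<close>.\<close>
  define blk where "blk j = (if even j then (j div 2) div n else (j div 2) mod n)" for j
  \<comment> \<open>The offset \<open>1 / (j + 2)\<close> differs for all \<open>j\<close> and lies
    in \<open>(0, 1/2]\<close>. Thus the caps of block \<open>v\<close> sit at parameters just above
    \<open>v\<close>, and the vertex itself at \<open>v\<close>.\<close>
  define T where "T j = real (blk j) + 1 / (real j + 2)" for j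
  define m where "m = 2 * (n * n)"
  have T: "real (blk j) < T j" "T j \<le> real (blk j) + 1/2" for j
    by (auto simp: T_def field_simps)
  have T_inj: "j = k" if "T j = T k" for j k
  proof -
    have "blk j = blk k"
      using T[of j] T[of k] that by linarith
    then have "1 / (real j + 2) = 1 / (real k + 2)"
      using that by (simp add: T_def)
    then show ?thesis
      by (simp add: field_simps)
  qed
  have T_vertex: "T j \<noteq> real v" for j v
  proof
    assume "T j = real v"
    then have "real (blk j) < real v" "real v < real (blk j) + 1"
      using T[of j] by linarith+
    then have "blk j < v" "v < blk j + 1"
      by linarith+
    then show False
      by simp
  qed
  define c where "c j = equator (T j)" for j
  have "inj_on c {..<m}"
    using T_inj inj_equator by (auto simp: c_def inj_on_def inj_def)
  then obtain r where r: "0 < r" "r < 1"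
    "\<And>i j x. i < m \<Longrightarrow> j < m \<Longrightarrow> i \<noteq> j \<Longrightarrow> norm x = 1 \<Longrightarrow> r \<le> x \<bullet> c i \<Longrightarrow> x \<bullet> c j < r"
    using caps_separated[of m c] by (force simp: c_def norm_equator)
  \<comment> \<open>Any level strictly between \<open>r\<close> and 1 would do; \<open>r\<close>
    itself becomes the lower level of the locale.\<close>
  define \<rho> where "\<rho> = (1 + r) / 2"
  interpret equatorial_caps "n * n" c "axis 3 1" \<rho> r
  proof
    show "norm (axis 3 (1::real) :: real^3) = 1"
      by simp
  qed (use r in \<open>simp_all add: c_def norm_equator equator_axis \<rho>_def m_def\<close>)
  \<comment> \<open>With the vertex scaled by \<rho>, a half-edge is the scaled copy of a full chord
    of the equator, so the chord lemmas apply.\<close>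
  define a where "a v = \<rho> *\<^sub>R equator (real v)" for v
  have q: "(1 - s) *\<^sub>R a v + s *\<^sub>R \<rho> *\<^sub>R c j = \<rho> *\<^sub>R ((1 - s) *\<^sub>R equator (real v) + s *\<^sub>R equator (T j))" for s v j
    by (simp add: a_def c_def algebra_simps)
  have "embeddable {..<n} (complete_edges n) M"
  proof (rule embeddable_complete_graph)
    show "n * n = n * n" ..
    show "a v \<bullet> axis 3 1 = 0" "norm (a v) \<le> 1" for v
      using rho by (simp_all add: a_def equator_axis norm_equator)
    show "a v \<bullet> c j < \<rho>" for v j
    proof -
      have "equator (real v) \<noteq> equator (T j)"
        using inj_equator T_vertex by (metis injD)
      moreover have "equator (real v) \<bullet> equator (real v) = 1" "equator (T j) \<bullet> equator (T j) = 1"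
        using norm_equator norm_eq_1 by blast+
      ultimately have "equator (real v) \<bullet> equator (T j) < 1"
        using inner_gt_zero_iff[of "equator (real v) - equator (T j)"]
        by (simp add: inner_diff_left inner_diff_right inner_commute[of "equator (T j)" "equator (real v)"])
      then show ?thesis
        using rho by (simp add: a_def c_def)
    qed
    show "blk (2 * (v * n + w)) = v" "blk (2 * (v * n + w) + 1) = w" if "v < n" "w < n" for v w
      using that by (simp_all add: blk_def)
    show "blk j < n" if "j < 2 * (n * n)" for j
      using that assms by (auto simp: blk_def less_mult_imp_div_less)
    have same_block: "v = w"
      if "(1 - s) *\<^sub>R equator (real v) + s *\<^sub>R equator x = (1 - t) *\<^sub>R equator (real w) + t *\<^sub>R equator y"
        "0 \<le> s" "s \<le> 1" "0 \<le> t" "t \<le> 1" "real v \<le> x" "x \<le> real v + 1/2" "real w \<le> y" "y \<le> real w + 1/2"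
      for s t v w x y
    proof (rule ccontr)
      assume "v \<noteq> w"
      then have "real w + 1 \<le> real v \<or> real v + 1 \<le> real w"
        by linarith
      then show False
        \<comment> \<open>The parameters in \<open>[v, v + 1/2]\<close> lie strictly between these
          bounds, and those in \<open>[w, w + 1/2]\<close> for \<open>w \<noteq> v\<close> lie
          strictly outside.\<close>
        using that(6-9) by (intro chords_separated[OF that(1-5), of "real v - 1/4" "real v + 3/4"]) linarith+
    qed
    show "j = k \<and> s = t"
      if "0 < s" "s \<le> 1" "0 < t" "t \<le> 1"
        "(1 - s) *\<^sub>R a (blk j) + s *\<^sub>R \<rho> *\<^sub>R c j = (1 - t) *\<^sub>R a (blk k) + t *\<^sub>R \<rho> *\<^sub>R c k" for j k s t
    proof -
      have eq: "(1 - s) *\<^sub>R equator (real (blk j)) + s *\<^sub>R equator (T j) =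
          (1 - t) *\<^sub>R equator (real (blk k)) + t *\<^sub>R equator (T k)"
        using that(5) rho unfolding q by simp
      have "blk j = blk k"
        by (rule same_block[OF eq]) (use that T[of j] T[of k] in auto)
      note eq' = eq[folded this]
      have "T j = T k"
        using chords_same_start[OF eq'] that T_vertex by simp
      then have "j = k"
        by (rule T_inj)
      moreover have "s = t"
        using chord_ends[OF eq'[folded \<open>T j = T k\<close>]] T_vertex[of j "blk j"] by simp
      ultimately show ?thesis
        by simp
    qed
    show "(1 - s) *\<^sub>R a (blk j) + s *\<^sub>R \<rho> *\<^sub>R c j \<noteq> a v" if "0 < s" "s \<le> 1" for j s v
    proof
      assume "(1 - s) *\<^sub>R a (blk j) + s *\<^sub>R \<rho> *\<^sub>R c j = a v"
      \<comment> \<open>The vertex is written as a degenerate chord from \<open>v\<close> to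
        \<open>v\<close>, so that \<open>same_block\<close> applies to it.\<close>
      then have eq: "(1 - s) *\<^sub>R equator (real (blk j)) + s *\<^sub>R equator (T j) =
          (1 - 0) *\<^sub>R equator (real v) + 0 *\<^sub>R equator (real v)"
        using rho unfolding q by (simp add: a_def)
      have "blk j = v"
        by (rule same_block[OF eq]) (use that T[of j] in auto)
      then have "(1 - s) *\<^sub>R equator (real v) + s *\<^sub>R equator (T j) =
          (1 - 0) *\<^sub>R equator (real v) + 0 *\<^sub>R equator (T j)"
        using eq by simp
      then have "s = 0"
        using chord_ends T_vertex by metis
      with that show False
        by simp
    qed
    show "inj_on a {..<n}"
    proof (rule inj_onI)
      fix v w assume "a v = a w"
      then have "equator (real v) = equator (real w)"
        using rho by (simp add: a_def)
      then show "v = w"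
        using injD[OF inj_equator] by fastforce
    qed
  qed
  moreover have "0 < n * n"
    using assms by simp
  ultimately show ?thesis
    using surface_M euler_genus_M by blast
qed

theorem mainTheorem9:
  shows "\<exists>c::real. c > 0 \<and>
    infinite {g::nat. g > 0 \<and>
      (\<exists>(M :: (real^3) set topology) (V :: nat set) (E :: nat set set).
         surface M \<and> has_euler_genus M g \<and>
         simple_graph V E \<and> embeddable V E M \<and>
         \<not> (\<exists>\<phi>. defective_coloring V E
               [2, \<lfloor>c * sqrt (real g)\<rfloor>, \<lfloor>c * sqrt (real g)\<rfloor>] \<phi>))}"
    (is "\<exists>c. c > 0 \<and> infinite (?G c)")
proof (intro exI conjI)
  \<comment> \<open>Twice the defect is about \<open>2 * c * sqrt 2 * n\<close>, which must stay
    below \<open>n\<close> by a margin; \<open>c = 1/4\<close> lies under the limit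
    \<open>1 / (2 * sqrt 2)\<close>.\<close>
  have "2 * (n * n) \<in> ?G (1/4)" if n: "20 < n" for n :: nat
  proof -
    define D where "D = \<lfloor>1/4 * sqrt (real (2 * (n * n)))\<rfloor>"
    have "sqrt (real (2 * (n * n))) \<le> sqrt ((3/2 * real n)\<^sup>2)"
      by (rule real_sqrt_le_mono) (simp add: power2_eq_square)
    then have "1/4 * sqrt (real (2 * (n * n))) \<le> 3/8 * real n"
      by simp
    then have "real_of_int D \<le> 3/8 * real n"
      unfolding D_def by linarith
    \<comment> \<open>The real estimate \<open>2 * D \<le> 3/4 * n\<close> suffices from
      \<open>n = 24\<close> on; for 21, 22 and 23 integrality of \<open>D\<close> is used.\<close>
    then have "2 * D + 6 \<le> int n"
      using n by linarith
    moreover have "0 \<le> D"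
      by (simp add: D_def)
    ultimately have "\<not> defective_coloring {..<n} (complete_edges n) [2, D, D] \<phi>" for \<phi>
      by (intro complete_graph_not_defective_colorable)
    then show ?thesis
      using complete_graph_on_surface[of n] simple_graph_complete[of n] n unfolding D_def by fastforce
  qed
  then have "(\<lambda>n. 2 * (n * n)) ` {20<..} \<subseteq> ?G (1/4)"
    by blast
  moreover have "inj_on (\<lambda>n::nat. 2 * (n * n)) {20<..}"
    by (rule inj_onI) (metis mult_left_cancel power2_eq_iff_nonneg power2_eq_square zero_le zero_neq_numeral)
  then have "infinite ((\<lambda>n::nat. 2 * (n * n)) ` {20<..})"
    by (simp add: finite_image_iff infinite_Ioi)
  ultimately show "infinite (?G (1/4))"
    using infinite_super by blast
qed simp

end
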